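(* For a positive integer $n$, let $a(n)$ be the number of isomorphism classes of connected $3$-regular permutation graphs on $n$ vertices. If $n$ is odd or $n \in \{2, 8, 12\}$, then $a(n) = 0$. If $n \in \{4, 6, 10, 14, 16, 18, 20\}$, then $a(n) = 1$. For even $n > 20$, \[ a(n) = \begin{cases} a(n-4)+a(n-6) & \text{if } n\equiv 2 \pmod{4},\\ a(n-4)+a(n-6)-t\!\left(\frac{n-20}{4}\right) & \text{if } n\equiv 0 \pmod{4}, \end{cases} \] where $t(x)$ is the number of compositions of $x$ into parts of size $2$ or $3$.
   Context: All graphs are finite and simple. A graph $G$ on $n$ vertices is a permutation graph if there is a labeling $v_1, \ldots, v_n$ of its vertices and a permutation $\pi$ of $\{1,\ldots,n\}$ such that for $i<j$, the vertices $v_i$ and $v_j$ are adjacent if and only if $\pi(i) > \pi(j)$. A composition of a nonnegative integer $x$ into parts of size $2$ or $3$ is an ordered finite sequence (possibly empty, when $x=0$) of elements of $\{2,3\}$ summing to $x$. *)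

theory Defs
  imports "Graph_Theory.Graph_Theory" "HOL-Combinatorics.Permutations"
begin

text \<open>
  A finite simple graph is a \<^locale>\<open>pair_graph\<close>: every undirected edge \<open>uv\<close> is the
  pair of arcs \<open>(u, v)\<close>, \<open>(v, u)\<close>, so \<open>out_degree\<close> is the number of neighbours.
\<close>

definition permutation_graph :: "'a pair_pre_digraph \<Rightarrow> bool" where
  "permutation_graph G \<longleftrightarrow> pair_graph G \<and>
    (\<exists>v \<pi>. bij_betw v {1..card (pverts G)} (pverts G) \<and> \<pi> permutes {1..card (pverts G)} \<and>
      (\<forall>i\<in>{1..card (pverts G)}. \<forall>j\<in>{1..card (pverts G)}. i < j \<longrightarrow>
        ((v i, v j) \<in> parcs G \<longleftrightarrow> \<pi> i > \<pi> j)))"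

definition regular_graph :: "nat \<Rightarrow> 'a pair_pre_digraph \<Rightarrow> bool" where
  "regular_graph d G \<longleftrightarrow> (\<forall>v\<in>pverts G. out_degree (with_proj G) v = d)"

text \<open>
  Every graph on \<open>n\<close> vertices is isomorphic to one with vertex set \<open>{1..n}\<close>, so isomorphism
  classes are counted among the latter.
\<close>

definition connected_cubic_permutation_graphs :: "nat \<Rightarrow> nat pair_pre_digraph set" where
  "connected_cubic_permutation_graphs n = {G. pair_graph G \<and> pverts G = {1..n} \<and>
     connected (with_proj G) \<and> regular_graph 3 G \<and> permutation_graph G}"

definition graph_iso_rel :: "('a pair_pre_digraph \<times> 'a pair_pre_digraph) set" where
  "graph_iso_rel = {(G, H). digraph_iso (with_proj G) (with_proj H)}"

definition num_connected_cubic_permutation_graphs :: "nat \<Rightarrow> nat" where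
  "num_connected_cubic_permutation_graphs n =
     card (connected_cubic_permutation_graphs n // (graph_iso_rel \<inter>
       connected_cubic_permutation_graphs n \<times> connected_cubic_permutation_graphs n))"

definition compositions_2_3 :: "nat \<Rightarrow> nat list set" where
  "compositions_2_3 x = {xs. set xs \<subseteq> {2, 3} \<and> sum_list xs = x}"

end

theory Submission
  imports Defs
begin

text \<open>
  Draw the permutation as the points \<open>(i, \<pi> i)\<close>; two vertices are adjacent iff one point lies to the
  left of and above the other. A point \<open>(p, q)\<close> with \<open>l\<close> neighbours on its upper left and \<open>r\<close> on its
  lower right satisfies \<open>p - q = l - r\<close>, so in a cubic diagram \<open>p - q\<close> is \<open>\<plusminus>1\<close> or \<open>\<plusminus>3\<close>. Scanning
  positions from the left, this leaves almost no choice: apart from \<open>K\<^sub>4\<close> and \<open>K\<^sub>3\<^sub>,\<^sub>3\<close> the diagram starts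
  with a cap on 5 vertices, continues with blocks that are diamonds (4 vertices) or copies of
  \<open>K\<^sub>3\<^sub>,\<^sub>3\<close> minus an edge (6 vertices), and ends with a cap, consecutive pieces being joined by bridges.
  So the graphs on \<open>10 + 2 m\<close> vertices are given by compositions of \<open>m\<close> into parts 2 (diamond) and
  3 (\<open>K\<^sub>3\<^sub>,\<^sub>3\<close> minus an edge). The composition can be read off the abstract graph starting from either
  cap, hence it is an isomorphism invariant exactly up to reversal. Counting compositions and
  palindromic compositions gives the recurrences.
\<close>

section \<open>Cubic permutation diagrams\<close>

text \<open>Since l + r = 3, the displacement p - q is odd; the few points that can lie to the left
  or below bound l or r, so each new point has very few possible places, and most of these are
  already taken. The obstacle is the diamond: the remainder after it has its gap among the positions
  instead of the values. It is therefore transposed, which does not change crossings. The same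
  symmetry at the start gives every chain a second, transposed diagram.

  The correction term comes from palindromes. Let c(m) count the compositions of m; twice the number
  of reversal classes is c(m) plus the number of palindromes. The first summand satisfies c(m) =
  c(m-2) + c(m-3). Palindromes number c(m/2) + c(m/2 - 1) for even m and c((m-3)/2) for odd m. For m
  at least 6 they obey the same recurrence if m is even and fall short of it by 2 c((m-5)/2) if m is
  odd. With n = 10 + 2 m the argument (m-5)/2 is (n-20)/4.\<close>

definition crosses :: "nat \<times> nat \<Rightarrow> nat \<times> nat \<Rightarrow> bool" where
  "crosses u v \<longleftrightarrow> fst u < fst v \<and> snd v < snd u \<or> fst v < fst u \<and> snd u < snd v"

lemma crosses_sym: "crosses u v \<longleftrightarrow> crosses v u"
  by (auto simp: crosses_def)

lemma crosses_irrefl [simp]: "\<not> crosses u u"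
  by (simp add: crosses_def)

lemma crosses_swap [simp]: "crosses (prod.swap u) (prod.swap v) \<longleftrightarrow> crosses u v"
  by (auto simp: crosses_def)

text \<open>
  The points to the right of a bridge, when positions \<open>1..k\<close> carry the values \<open>1..k-1\<close> and \<open>k+1\<close>. Past
  a diamond the roles of positions and values are exchanged, whence the swap.
\<close>

fun tail_points :: "nat \<Rightarrow> nat list \<Rightarrow> (nat \<times> nat) list" where
  "tail_points k [] = [(k+3,k), (k+1,k+4), (k+2,k+5), (k+4,k+3), (k+5,k+2)]"
| "tail_points k (b # w) =
    (if b = 2 then [(k+3,k), (k+1,k+4), (k+2,k+3), (k+5,k+2)] @ map prod.swap (tail_points (k+4) w)
     else [(k+3,k), (k+1,k+4), (k+2,k+5), (k+5,k+2), (k+6,k+3), (k+4,k+7)] @ tail_points (k+6) w)"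

definition chain_points :: "nat list \<Rightarrow> (nat \<times> nat) list" where
  "chain_points w = [(1,4), (2,3), (4,1), (5,2), (3,6)] @ tail_points 5 w"

section \<open>Displacement of a point and its two kinds of neighbours\<close>

definition left_above :: "(nat \<times> nat) set \<Rightarrow> nat \<times> nat \<Rightarrow> (nat \<times> nat) set" where
  "left_above U u = {v\<in>U. fst v < fst u \<and> snd u < snd v}"

definition right_below :: "(nat \<times> nat) set \<Rightarrow> nat \<times> nat \<Rightarrow> (nat \<times> nat) set" where
  "right_below U u = {v\<in>U. fst u < fst v \<and> snd v < snd u}"

lemma card_crosses:
  assumes "finite U"
  shows "card {v\<in>U. crosses u v} = card (left_above U u) + card (right_below U u)"
proof -
  have "{v\<in>U. crosses u v} = left_above U u \<union> right_below U u"
    by (auto simp: crosses_def left_above_def right_below_def)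
  moreover have "left_above U u \<inter> right_below U u = {}"
    by (auto simp: left_above_def right_below_def)
  ultimately show ?thesis
    using assms by (simp add: card_Un_disjoint left_above_def right_below_def)
qed

text \<open>The points to the left of \<open>u\<close> and the points below \<open>u\<close> share
  those on the lower left; cancelling them leaves the two kinds of neighbours. The position and
  value sets stay arbitrary because the identity is also applied to remainders with a gap.\<close>

lemma displacement:
  assumes "finite U" "inj_on fst U" "inj_on snd U" "u \<in> U"
  shows "card {p\<in>fst ` U. p < fst u} + card (right_below U u)
       = card {q\<in>snd ` U. q < snd u} + card (left_above U u)"
proof -
  let ?B = "{v\<in>U. fst v < fst u \<and> snd v < snd u}"
  have ne: "snd v \<noteq> snd u" if "v \<in> U" "fst v < fst u" for v
    using inj_onD[OF assms(3) _ that(1) assms(4)] that by auto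
  have ne': "fst v \<noteq> fst u" if "v \<in> U" "snd v < snd u" for v
    using inj_onD[OF assms(2) _ that(1) assms(4)] that by auto
  have 1: "{v\<in>U. fst v < fst u} = ?B \<union> left_above U u"
    by (auto simp: left_above_def dest: ne)
  have 2: "{v\<in>U. snd v < snd u} = ?B \<union> right_below U u"
    by (auto simp: right_below_def dest: ne')
  have 3: "card {v\<in>U. fst v < fst u} = card ?B + card (left_above U u)"
    unfolding 1 using assms(1) by (subst card_Un_disjoint) (auto simp: left_above_def)
  have 4: "card {v\<in>U. snd v < snd u} = card ?B + card (right_below U u)"
    unfolding 2 using assms(1) by (subst card_Un_disjoint) (auto simp: right_below_def)
  have "{p\<in>fst ` U. p < fst u} = fst ` {v\<in>U. fst v < fst u}"
       "{q\<in>snd ` U. q < snd u} = snd ` {v\<in>U. snd v < snd u}" by auto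
  moreover have "card (fst ` {v\<in>U. fst v < fst u}) = card {v\<in>U. fst v < fst u}"
    by (rule card_image) (rule inj_on_subset[OF assms(2)], auto)
  moreover have "card (snd ` {v\<in>U. snd v < snd u}) = card {v\<in>U. snd v < snd u}"
    by (rule card_image) (rule inj_on_subset[OF assms(3)], auto)
  ultimately show ?thesis using 3 4 by simp
qed

text \<open>Here q - p = r - l, which has the parity of l + r = 3.\<close>

lemma displacement_cases:
  fixes p q l r :: nat
  assumes "p + r = q + l" "l + r = 3"
  obtains "q = p + 3" | "q = p + 1" | "p = q + 1" | "p = q + 3"
proof -
  have "q = p + 3 \<or> q = p + 1 \<or> p = q + 1 \<or> p = q + 3"
    using assms by presburger
  then show thesis using that by blast
qed

text \<open>
  The diagram is not cut by the point \<open>(m, m)\<close>; for a full diagram either half of the condition implies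
  the other, but both are needed for the remainders of a diagram, which get swapped.
\<close>

definition uncut :: "nat \<Rightarrow> nat \<Rightarrow> (nat \<times> nat) set \<Rightarrow> bool" where
  "uncut k n U \<longleftrightarrow> (\<forall>m. k < m \<and> m < n \<longrightarrow>
     (\<exists>u\<in>U. fst u \<le> m \<and> m < snd u) \<and> (\<exists>u\<in>U. snd u \<le> m \<and> m < fst u))"

text \<open>The point of value \<open>k\<close> is one neighbour short: its third neighbour is the
  removed point of value \<open>k + 1\<close>, the near end of the bridge.\<close>

definition tail_state :: "nat \<Rightarrow> nat \<Rightarrow> (nat \<times> nat) set \<Rightarrow> bool" where
  "tail_state k n U \<longleftrightarrow> finite U \<and> inj_on fst U \<and> inj_on snd U \<and>
     fst ` U = {k+1..n} \<and> snd ` U = insert k {k+2..n} \<and>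
     (\<forall>u\<in>U. card {v\<in>U. crosses u v} = (if snd u = k then 2 else 3)) \<and> uncut k n U"

lemma card_le_2:
  assumes "A \<subseteq> {a, b}" shows "card A \<le> 2"
proof -
  have "card A \<le> card {a, b}" using assms by (rule card_mono[rotated]) simp
  also have "\<dots> \<le> 2" by (simp add: card_insert_if)
  finally show ?thesis .
qed

lemma card_le_1:
  assumes "A \<subseteq> {a}" shows "card A \<le> 1"
  using card_mono[OF _ assms] by simp

text \<open>All removed points except \<open>z\<close> lie to the lower left of the remainder. The
  value \<open>k' + 1\<close> of \<open>z\<close> exceeds only the value \<open>k'\<close>, so
  exactly that point loses a neighbour. No removed point straddles a level m > k', hence the
  witnesses of \<open>uncut\<close> survive.\<close>

lemma tail_state_remove:
  assumes U: "finite U" "inj_on fst U" "inj_on snd U" "uncut k n U"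
    and U': "U' \<subseteq> U" and k: "k < k'"
    and fst: "fst ` U' = {k'+1..n}" and snd: "snd ` U' = insert k' {k'+2..n}"
    and z: "z \<in> U" "fst z < k'" "snd z = k' + 1"
    and rest: "\<And>v. v \<in> U - U' \<Longrightarrow> v \<noteq> z \<Longrightarrow> fst v \<le> k' \<and> snd v < k'"
    and deg: "\<And>u. u \<in> U' \<Longrightarrow> card {v\<in>U. crosses u v} = 3"
  shows "tail_state k' n U'"
proof -
  have fU: "k' < fst u \<and> fst u \<le> n" if "u \<in> U'" for u
    using imageI[OF that, of fst] unfolding fst by simp
  have sU: "snd u = k' \<or> k' + 2 \<le> snd u" if "u \<in> U'" for u
    using imageI[OF that, of snd] unfolding snd by auto
  have zU': "z \<notin> U'" using fU[of z] z by auto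
  have "card {v\<in>U'. crosses u v} = (if snd u = k' then 2 else 3)" if u: "u \<in> U'" for u
  proof -
    have fu: "k' < fst u" using fU[OF u] by simp
    note su = sU[OF u]
    note 3 = deg[OF u]
    have no: "\<not> crosses u v" if "v \<in> U - U'" "v \<noteq> z" for v
      using rest[OF that] fu su by (auto simp: crosses_def)
    have zc: "crosses u z \<longleftrightarrow> snd u = k'"
      using fu su z by (auto simp: crosses_def)
    show ?thesis
    proof (cases "snd u = k'")
      case True
      then have "{v\<in>U. crosses u v} = insert z {v\<in>U'. crosses u v}"
        using no zc z(1) U' by blast
      moreover have "finite {v\<in>U'. crosses u v}" using U(1) U' finite_subset by fastforce
      ultimately have "Suc (card {v\<in>U'. crosses u v}) = 3" using 3 zU' by simp
      then show ?thesis using True by simp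
    next
      case False
      then have "{v\<in>U. crosses u v} = {v\<in>U'. crosses u v}" using no zc U' by blast
      then show ?thesis using 3 False by simp
    qed
  qed
  moreover have "uncut k' n U'"
    unfolding uncut_def
  proof (intro allI impI)
    fix m assume m: "k' < m \<and> m < n"
    then have "k < m \<and> m < n" using k by simp
    then obtain u v where uv: "u \<in> U" "fst u \<le> m" "m < snd u" "v \<in> U" "snd v \<le> m" "m < fst v"
      using U(4) unfolding uncut_def by meson
    have "u \<in> U'" using rest[of u] uv m z by (cases "u = z") auto
    moreover have "v \<in> U'" using rest[of v] uv m z by (cases "v = z") auto
    ultimately show "(\<exists>u\<in>U'. fst u \<le> m \<and> m < snd u) \<and> (\<exists>u\<in>U'. snd u \<le> m \<and> m < fst u)"
      using uv by blast
  qed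
  ultimately show ?thesis
    unfolding tail_state_def
    using U' fst snd finite_subset[OF U' U(1)] inj_on_subset[OF U(2) U'] inj_on_subset[OF U(3) U']
    by blast
qed

lemma diagram_swap:
  "finite (prod.swap ` U) \<longleftrightarrow> finite U" "inj_on fst (prod.swap ` U) \<longleftrightarrow> inj_on snd U"
  "inj_on snd (prod.swap ` U) \<longleftrightarrow> inj_on fst U" "uncut k n (prod.swap ` U) \<longleftrightarrow> uncut k n U"
  "card {v\<in>prod.swap ` U. crosses (prod.swap u) v} = card {v\<in>U. crosses u v}"
proof -
  have inj: "inj_on prod.swap A" for A :: "(nat \<times> nat) set" by (auto intro: inj_onI)
  show "finite (prod.swap ` U) \<longleftrightarrow> finite U" by (rule finite_image_iff) (rule inj)
  show "inj_on fst (prod.swap ` U) \<longleftrightarrow> inj_on snd U" "inj_on snd (prod.swap ` U) \<longleftrightarrow> inj_on fst U"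
    by (simp_all add: comp_inj_on_iff[OF inj] comp_def)
  show "uncut k n (prod.swap ` U) \<longleftrightarrow> uncut k n U"
    unfolding uncut_def by auto
  have "{v\<in>prod.swap ` U. crosses (prod.swap u) v} = prod.swap ` {v\<in>U. crosses u v}"
    by (auto simp: crosses_def)
  then show "card {v\<in>prod.swap ` U. crosses (prod.swap u) v} = card {v\<in>U. crosses u v}"
    using card_image[OF inj] by simp
qed

text \<open>The places of value \<open>k\<close>, position \<open>k + 1\<close> and value
  \<open>k + 2\<close> are forced. Position \<open>k + 2\<close> decides whether a diamond follows;
  if not, value \<open>k + 3\<close> decides between the cap and the other block.\<close>

lemma tail_state_cases:
  assumes "tail_state k n U"
  obtains (cap) "n = k + 5" "U = set (tail_points k [])"
  | (diamond) U' where "U = {(k+3,k), (k+1,k+4), (k+2,k+3), (k+5,k+2)} \<union> prod.swap ` U'"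
      "tail_state (k+4) n U'"
  | (kblock) U' where "U = {(k+3,k), (k+1,k+4), (k+2,k+5), (k+5,k+2), (k+6,k+3), (k+4,k+7)} \<union> U'"
      "tail_state (k+6) n U'"
proof -
  note U = assms[unfolded tail_state_def]
  have fin: "finite U" and injs: "inj_on fst U" "inj_on snd U" and unc: "uncut k n U"
    and fU: "fst ` U = {k+1..n}" and sU: "snd ` U = insert k {k+2..n}"
    using U by auto
  have deg: "card {v\<in>U. crosses u v} = (if snd u = k then 2 else 3)" if "u \<in> U" for u
    using U that by auto
  have range: "k + 1 \<le> p" "p \<le> n" "q = k \<or> k + 2 \<le> q" "k \<le> q" "q \<le> n" if "(p,q) \<in> U" for p q
  proof -
    have "p \<in> {k+1..n}" using imageI[OF that, of fst] unfolding fU by simp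
    moreover have "q \<in> insert k {k+2..n}" using imageI[OF that, of snd] unfolding sU by simp
    ultimately show "k + 1 \<le> p" "p \<le> n" "q = k \<or> k + 2 \<le> q" "k \<le> q" "q \<le> n" by auto
  qed
  have same_pos: "q = q'" if "(p,q) \<in> U" "(p,q') \<in> U" for p q q'
    using inj_onD[OF injs(1) _ that] by simp
  have same_val: "p = p'" if "(p,q) \<in> U" "(p',q) \<in> U" for p p' q
    using inj_onD[OF injs(2) _ that] by simp
  have ex_pos: "\<exists>q. (p,q) \<in> U" if "k + 1 \<le> p" "p \<le> n" for p
  proof -
    have "p \<in> fst ` U" unfolding fU using that by simp
    then show ?thesis by force
  qed
  have ex_val: "\<exists>p. (p,q) \<in> U" if "q = k \<or> k + 2 \<le> q \<and> q \<le> n" for q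
  proof -
    have "q \<in> snd ` U" unfolding sU using that by auto
    then show ?thesis by force
  qed
  have LR: "card (left_above U (p,q)) + card (right_below U (p,q)) = (if q = k then 2 else 3)"
    if "(p,q) \<in> U" for p q
    using card_crosses[OF fin, of "(p,q)"] deg[OF that] by simp
  have disp: "p + card (right_below U (p,q)) = q + card (left_above U (p,q))"
    if pq: "(p,q) \<in> U" "q \<noteq> k" for p q
  proof -
    note r = range[OF pq(1)]
    have "{x\<in>fst ` U. x < p} = {k+1..<p}" using r unfolding fU by auto
    moreover have "{x\<in>snd ` U. x < q} = insert k {k+2..<q}" using r pq(2) unfolding sU by auto
    ultimately show ?thesis using displacement[OF fin injs pq(1)] r pq(2) by simp
  qed
  have "k \<in> snd ` U" unfolding sU by simp
  then obtain py where py: "(py,k) \<in> U" by force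
  \<comment> \<open>Nothing lies below the smallest value, so both neighbours of this point are on
    its upper left, and they are all the points left of it: positions \<open>k + 1\<close> and
    \<open>k + 2\<close>.\<close>
  have "right_below U (py,k) = {}" using range(4) by (fastforce simp: right_below_def)
  then have "card (left_above U (py,k)) = 2" using LR[OF py] by simp
  moreover have "{x\<in>fst ` U. x < py} = {k+1..<py}" using range[OF py] unfolding fU by auto
  then have "card {x\<in>fst ` U. x < py} = py - (k + 1)" by simp
  moreover have "{x\<in>snd ` U. x < k} = {}" unfolding sU by auto
  then have "card {x\<in>snd ` U. x < k} = 0" by (simp only: card.empty)
  moreover have "card (right_below U (py,k)) = 0" using \<open>right_below U (py,k) = {}\<close> by simp
  ultimately have "py = k + 3"
    using displacement[OF fin injs py, unfolded fst_conv snd_conv] range(1)[OF py] by linarith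
  note y = py[unfolded this]
  have n3: "k + 3 \<le> n" using range[OF y] by simp
  obtain a where a: "(k+1,a) \<in> U" using ex_pos n3 by fastforce
  obtain b where b: "(k+2,b) \<in> U" using ex_pos n3 by fastforce
  have ak: "a \<noteq> k" "b \<noteq> k" using same_val y a b by fastforce+
  have "left_above U (k+1,a) = {}" using range(1) by (fastforce simp: left_above_def)
  then have "a = k + 4" using disp[OF a ak(1)] LR[OF a] ak by simp
  note a = a[unfolded this]
  have n4: "k + 4 \<le> n" using range[OF a] by simp
  have "left_above U (k+2,b) \<subseteq> {(k+1,k+4)}"
  proof
    fix v assume "v \<in> left_above U (k+2,b)"
    then obtain p q where v: "v = (p,q)" "(p,q) \<in> U" "p < k + 2" "b < q" 
      by (cases v) (auto simp: left_above_def)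
    then have "p = k + 1" using range(1)[OF v(2)] by simp
    then show "v \<in> {(k+1,k+4)}" using v same_pos a by auto
  qed
  \<comment> \<open>One upper left neighbour gives displacement +1, none gives +3.\<close>
  from card_le_1[OF this] have L: "card (left_above U (k+2,b)) \<in> {0,1}" by auto
  then have b_cases: "b = k + 3 \<or> b = k + 5" using disp[OF b ak(2)] LR[OF b] ak by auto
  obtain pc where c: "(pc,k+2) \<in> U" using ex_val n4 by fastforce
  have "right_below U (pc,k+2) \<subseteq> {(k+3,k)}"
  proof
    fix v assume "v \<in> right_below U (pc,k+2)"
    then obtain p q where v: "v = (p,q)" "(p,q) \<in> U" "q < k + 2"
      by (cases v) (auto simp: right_below_def)
    then have "q = k" using range(3)[OF v(2)] by simp
    then show "v \<in> {(k+3,k)}" using v same_val y by auto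
  qed
  from card_le_1[OF this] have "card (right_below U (pc,k+2)) \<in> {0,1}" by auto
  \<comment> \<open>The other possibility, displacement by one, would need the position of the
    bridge end \<open>(k+3,k)\<close>.\<close>
  moreover have "pc \<noteq> k + 3" using c y same_pos by fastforce
  ultimately have "pc = k + 5" using disp[OF c] LR[OF c] by auto
  note c = c[unfolded this]
  have n5: "k + 5 \<le> n" using range[OF c] by simp
  show thesis
  proof (cases "b = k + 3")
    case True
    note b = b[unfolded True]
    let ?B = "{(k+3,k), (k+1,k+4), (k+2,k+3), (k+5,k+2)}"
    let ?V = "U - ?B"
    have B: "?B \<subseteq> U" using a b c y by simp
    have "fst ` ?V = fst ` U - fst ` ?B" by (rule inj_on_image_set_diff[OF injs(1) _ B]) auto
    also have "\<dots> = insert (k+4) {k+4+2..n}" using n5 unfolding fU by auto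
    finally have f: "fst ` ?V = insert (k+4) {k+4+2..n}" .
    have "snd ` ?V = snd ` U - snd ` ?B" by (rule inj_on_image_set_diff[OF injs(2) _ B]) auto
    also have "\<dots> = {k+4+1..n}" using n5 unfolding sU by auto
    finally have s: "snd ` ?V = {k+4+1..n}" .
    \<comment> \<open>The positions \<open>k + 4, k + 6, ...\<close> and the values
      \<open>k + 5, ...\<close> are left, so the gap has moved to the positions. After transposition
      the point \<open>(k+5,k+2)\<close> becomes the near end \<open>z\<close> of the next
      bridge.\<close>
    have "tail_state (k+4) n (prod.swap ` ?V)"
    proof (rule tail_state_remove[where U = "prod.swap ` U" and k = k and z = "(k+2,k+5)"])
      show "fst ` prod.swap ` ?V = {k+4+1..n}" unfolding s[symmetric] by force
      show "snd ` prod.swap ` ?V = insert (k+4) {k+4+2..n}" unfolding f[symmetric] by force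
      show "card {v\<in>prod.swap ` U. crosses u v} = 3" if "u \<in> prod.swap ` ?V" for u
      proof -
        from that obtain v where v: "u = prod.swap v" "v \<in> ?V" by auto
        have "snd v \<in> {k+4+1..n}" using imageI[OF v(2), of snd] unfolding s .
        then show ?thesis using deg[of v] v(2) unfolding v(1) diagram_swap by auto
      qed
    qed (use fin injs unc B in \<open>auto simp: diagram_swap\<close>)
    moreover have "U = ?B \<union> prod.swap ` prod.swap ` ?V" using B by (auto simp: image_image)
    ultimately show thesis using diamond by blast
  next
    case False
    then have "b = k + 5" using b_cases by simp
    note b = b[unfolded this]
    obtain pd where d: "(pd,k+3) \<in> U" using ex_val n5 by fastforce
    have "right_below U (pd,k+3) \<subseteq> {(k+3,k), (k+5,k+2)}"
    proof
      fix v assume "v \<in> right_below U (pd,k+3)"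
      then obtain p q where v: "v = (p,q)" "(p,q) \<in> U" "q < k + 3"
        by (cases v) (auto simp: right_below_def)
      then have "q = k \<or> q = k + 2" using range(3)[OF v(2)] by auto
      then show "v \<in> {(k+3,k), (k+5,k+2)}" using v same_val y c by auto
    qed
    from card_le_2[OF this] have "card (right_below U (pd,k+3)) \<in> {0,1,2}" by auto
    \<comment> \<open>Two lower right neighbours would put value \<open>k + 3\<close> at position
      \<open>k + 2\<close>, which carries \<open>k + 5\<close> here; one or none remain.\<close>
    moreover have "pd \<noteq> k + 2" using d b same_pos by fastforce
    ultimately have "pd = k + 4 \<or> pd = k + 6" using disp[OF d] LR[OF d] by auto
    then show thesis
    proof
      assume "pd = k + 4"
      note d = d[unfolded this]
      let ?B = "set (tail_points k [])"
      have B: "?B \<subseteq> U" using a b c d y by simp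
      \<comment> \<open>The first five positions of the remainder carry no value above
        \<open>k + 5\<close>, so a longer diagram would be cut there.\<close>
      have "n = k + 5"
      proof (rule ccontr)
        assume "n \<noteq> k + 5"
        then have "k < k + 5 \<and> k + 5 < n" using n5 by simp
        then obtain u where u: "u \<in> U" "fst u \<le> k + 5" "k + 5 < snd u"
          using unc unfolding uncut_def by blast
        obtain p q where pq: "u = (p,q)" by fastforce
        have "p \<in> {k+1,k+2,k+3,k+4,k+5}" using range(1)[of p q] u pq by auto
        then show False using u pq a b c d y same_pos by fastforce
      qed
      moreover have "U = ?B"
      proof (rule card_subset_eq[symmetric, OF fin B])
        have "card U = card (fst ` U)" by (rule card_image[OF injs(1), symmetric])
        also have "\<dots> = 5" unfolding fU \<open>n = k + 5\<close> by simp
        finally show "card ?B = card U" by simp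
      qed
      ultimately show thesis using cap by blast
    next
      assume "pd = k + 6"
      note d = d[unfolded this]
      have n6: "k + 6 \<le> n" using range[OF d] by simp
      obtain e where e: "(k+4,e) \<in> U" using ex_pos n6 by fastforce
      have "e \<notin> {k,k+2,k+3,k+4,k+5}" using same_val e a b c d y by fastforce
      then have "k + 6 \<le> e" using range(3)[OF e] by auto
      then have "e \<noteq> k" by simp
      then have "card (left_above U (k+4,e)) + card (right_below U (k+4,e)) = 3" using LR[OF e] by simp
      \<comment> \<open>All values up to \<open>k + 5\<close> are taken or absent, so of the four
        displacements only +3 is possible.\<close>
      then have "e = k + 7"
        using \<open>k + 6 \<le> e\<close> by (cases rule: displacement_cases[OF disp[OF e \<open>e \<noteq> k\<close>]]) simp_all
      note e = e[unfolded this]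
      let ?B = "{(k+3,k), (k+1,k+4), (k+2,k+5), (k+5,k+2), (k+6,k+3), (k+4,k+7)}"
      let ?V = "U - ?B"
      have n7: "k + 7 \<le> n" using range[OF e] by simp
      have B: "?B \<subseteq> U" using a b c d e y by simp
      have "fst ` ?V = fst ` U - fst ` ?B" by (rule inj_on_image_set_diff[OF injs(1) _ B]) auto
      also have "\<dots> = {k+6+1..n}" using n7 unfolding fU by auto
    finally have f: "fst ` ?V = {k+6+1..n}" .
      have "snd ` ?V = snd ` U - snd ` ?B" by (rule inj_on_image_set_diff[OF injs(2) _ B]) auto
      also have "\<dots> = insert (k+6) {k+6+2..n}" using n7 unfolding sU by auto
    finally have s: "snd ` ?V = insert (k+6) {k+6+2..n}" .
      have "tail_state (k+6) n ?V"
      proof (rule tail_state_remove[where U = U and k = k and z = "(k+4,k+7)"])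
        show "card {v\<in>U. crosses u v} = 3" if "u \<in> ?V" for u
        proof -
          have "snd u \<in> insert (k+6) {k+6+2..n}" using imageI[OF that, of snd] unfolding s .
          then show ?thesis using deg[of u] that by auto
        qed
      qed (use fin injs unc B f s in auto)
      then show thesis using B by (intro kblock[of ?V]) auto
    qed
  qed
qed

lemma tail_state_classification:
  assumes "tail_state k n U"
  shows "\<exists>w. set w \<subseteq> {2,3} \<and> U = set (tail_points k w)"
  using assms
proof (induction "n - k" arbitrary: k U rule: less_induct)
  case less
  have kn: "k < n" if "tail_state k n U" for k U
    using that unfolding tail_state_def by (cases "k < n") auto
  from less.prems show ?case
  proof (cases rule: tail_state_cases)
    case cap
    then show ?thesis by (intro exI[of _ "[]"]) simp
  next
    case (diamond U')
    have "n - (k + 4) < n - k" using kn[OF diamond(2)] by simp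
    from less.hyps[OF this diamond(2)] obtain w where
      "set w \<subseteq> {2,3}" "U' = set (tail_points (k+4) w)" by blast
    then show ?thesis using diamond(1) by (intro exI[of _ "2 # w"]) simp
  next
    case (kblock U')
    have "n - (k + 6) < n - k" using kn[OF kblock(2)] by simp
    from less.hyps[OF this kblock(2)] obtain w where
      "set w \<subseteq> {2,3}" "U' = set (tail_points (k+6) w)" by blast
    then show ?thesis using kblock(1) by (intro exI[of _ "3 # w"]) simp
  qed
qed

section \<open>The beginning of a full diagram\<close>

definition k4_points :: "(nat \<times> nat) list" where
  "k4_points = [(1,4), (2,3), (3,2), (4,1)]"

definition k33_points :: "(nat \<times> nat) list" where
  "k33_points = [(1,4), (4,1), (2,5), (5,2), (3,6), (6,3)]"

definition cubic_diagram :: "nat \<Rightarrow> (nat \<times> nat) set \<Rightarrow> bool" where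
  "cubic_diagram n U \<longleftrightarrow> finite U \<and> inj_on fst U \<and> inj_on snd U \<and> fst ` U = {1..n} \<and> snd ` U = {1..n} \<and>
     (\<forall>u\<in>U. card {v\<in>U. crosses u v} = 3) \<and> uncut 0 n U"

lemma cubic_diagram_swap: "cubic_diagram n (prod.swap ` U) \<longleftrightarrow> cubic_diagram n U"
proof -
  have "fst ` prod.swap ` U = snd ` U" "snd ` prod.swap ` U = fst ` U" by force+
  then show ?thesis
    unfolding cubic_diagram_def ball_simps diagram_swap by auto
qed

text \<open>Position 1 carries 4 and value 1 sits at 4. What remains is whether position 2 carries 3
  or 5, and whether value 2 sits at 3 or 5. The four combinations give K4, a chain, a transposed
  chain and K33; the transposed one is only recorded by its point \<open>(3,2)\<close>.\<close>

lemma cubic_diagram_start: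
  assumes "cubic_diagram n U" "n > 0"
  shows "n = 4 \<and> U = set k4_points \<or> n = 6 \<and> U = set k33_points \<or>
    (2,3) \<in> U \<and> (\<exists>w. set w \<subseteq> {2,3} \<and> U = set (chain_points w)) \<or> (3,2) \<in> U \<and> (2,3) \<notin> U"
proof -
  note U = assms(1)[unfolded cubic_diagram_def]
  have fin: "finite U" and injs: "inj_on fst U" "inj_on snd U" and unc: "uncut 0 n U"
    and fU: "fst ` U = {1..n}" and sU: "snd ` U = {1..n}"
    using U by auto
  have deg: "card {v\<in>U. crosses u v} = 3" if "u \<in> U" for u
    using U that by auto
  have range: "1 \<le> p" "p \<le> n" "1 \<le> q" "q \<le> n" if "(p,q) \<in> U" for p q
    using imageI[OF that, of fst] imageI[OF that, of snd] unfolding fU sU by auto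
  have same_pos: "q = q'" if "(p,q) \<in> U" "(p,q') \<in> U" for p q q'
    using inj_onD[OF injs(1) _ that] by simp
  have same_val: "p = p'" if "(p,q) \<in> U" "(p',q) \<in> U" for p p' q
    using inj_onD[OF injs(2) _ that] by simp
  have ex_pos: "\<exists>q. (p,q) \<in> U" if "1 \<le> p" "p \<le> n" for p
  proof -
    have "p \<in> fst ` U" unfolding fU using that by simp
    then show ?thesis by force
  qed
  have ex_val: "\<exists>p. (p,q) \<in> U" if "1 \<le> q" "q \<le> n" for q
  proof -
    have "q \<in> snd ` U" unfolding sU using that by auto
    then show ?thesis by force
  qed
  have LR: "card (left_above U (p,q)) + card (right_below U (p,q)) = 3"
    if "(p,q) \<in> U" for p q
    using card_crosses[OF fin, of "(p,q)"] deg[OF that] by simp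
  have disp: "p + card (right_below U (p,q)) = q + card (left_above U (p,q))"
    if pq: "(p,q) \<in> U" for p q
  proof -
    note r = range[OF pq(1)]
    have "{x\<in>fst ` U. x < p} = {1..<p}" using r unfolding fU by auto
    moreover have "{x\<in>snd ` U. x < q} = {1..<q}" using r unfolding sU by auto
    ultimately show ?thesis using displacement[OF fin injs pq(1)] r by simp
  qed
  \<comment> \<open>If the first \<open>m\<close> positions are filled with values up to
    \<open>m\<close>, the diagram would be cut at \<open>m\<close> unless it ends there.\<close>
  have closed: "n = m \<and> U = B" 
    if m: "1 \<le> m" "m \<le> n" and B: "B \<subseteq> U" "card B = m" and pos: "{1..m} \<subseteq> fst ` B" "snd ` B \<subseteq> {..m}" for m B
  proof -
    have "n = m"
    proof (rule ccontr)
      assume "n \<noteq> m"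
      then have "0 < m \<and> m < n" using m by simp
      then obtain u where u: "u \<in> U" "fst u \<le> m" "m < snd u"
        using unc unfolding uncut_def by blast
      obtain p q where pq: "u = (p,q)" by fastforce
      have "p \<in> fst ` B" using pos(1) range[of p q] u pq by auto
      then obtain q' where q': "(p,q') \<in> B" by force
      then have "q' \<le> m" "(p,q') \<in> U" using imageI[OF q', of snd] pos(2) B(1) by auto
      then show False using u pq same_pos[of p q q'] by simp
    qed
    moreover have "U = B"
    proof (rule card_subset_eq[symmetric, OF fin B(1)])
      have "card U = card (fst ` U)" by (rule card_image[OF injs(1), symmetric])
      also have "\<dots> = m" unfolding fU \<open>n = m\<close> by simp
      finally show "card B = card U" using B by simp
    qed
    ultimately show ?thesis by simp
  qed
  obtain a where a: "(1,a) \<in> U" using ex_pos assms(2) by fastforce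
  have "left_above U (1,a) = {}" using range(1) by (fastforce simp: left_above_def)
  then have "a = 4" using disp[OF a] LR[OF a] by simp
  note a = a[unfolded this]
  have n4: "4 \<le> n" using range[OF a] by simp
  obtain py where y: "(py,1) \<in> U" using ex_val assms(2) by fastforce
  have "right_below U (py,1) = {}" using range(3) by (fastforce simp: right_below_def)
  then have "py = 4" using disp[OF y] LR[OF y] by simp
  note y = y[unfolded this]
  obtain b where b: "(2,b) \<in> U" using ex_pos n4 by fastforce
  have "left_above U (2,b) \<subseteq> {(1,4)}"
  proof
    fix v assume "v \<in> left_above U (2,b)"
    then obtain p q where v: "v = (p,q)" "(p,q) \<in> U" "p < 2" by (cases v) (auto simp: left_above_def)
    then have "p = 1" using range(1)[OF v(2)] by simp
    then show "v \<in> {(1,4)}" using v same_pos a by auto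
  qed
  from card_le_1[OF this] have "card (left_above U (2,b)) \<in> {0,1}" by auto
  then have b_cases: "b = 3 \<or> b = 5" using disp[OF b] LR[OF b] by auto
  obtain pc where c: "(pc,2) \<in> U" using ex_val n4 by fastforce
  have "right_below U (pc,2) \<subseteq> {(4,1)}"
  proof
    fix v assume "v \<in> right_below U (pc,2)"
    then obtain p q where v: "v = (p,q)" "(p,q) \<in> U" "q < 2" by (cases v) (auto simp: right_below_def)
    then have "q = 1" using range(3)[OF v(2)] by simp
    then show "v \<in> {(4,1)}" using v same_val y by auto
  qed
  from card_le_1[OF this] have "card (right_below U (pc,2)) \<in> {0,1}" by auto
  then have c_cases: "pc = 3 \<or> pc = 5" using disp[OF c] LR[OF c] by auto
  obtain e where e: "(3,e) \<in> U" using ex_pos n4 by fastforce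
  consider "b = 3" "pc = 3" | "b = 3" "pc = 5" | "b = 5" "pc = 3" | "b = 5" "pc = 5"
    using b_cases c_cases by blast
  then show ?thesis
  proof cases
    case 1
    note b = b[unfolded 1] and c = c[unfolded 1]
    have "n = 4 \<and> U = set k4_points"
      by (rule closed) (use n4 a b c y in \<open>auto simp: k4_points_def\<close>)
    then show ?thesis by simp
  next
    case 2
    note b = b[unfolded 2] and c = c[unfolded 2]
    have n5: "5 \<le> n" using range[OF c] by simp
    have "e \<notin> {1,2,3,4}" using same_val e a b c y by fastforce
    then have "5 \<le> e" using range(3)[OF e] by auto
    then have "e = 6" by (cases rule: displacement_cases[OF disp[OF e] LR[OF e]]) simp_all
    note e = e[unfolded this]
    let ?B = "{(1,4), (2,3), (4,1), (5,2), (3,6)} :: (nat \<times> nat) set"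
    let ?V = "U - ?B"
    have n6: "6 \<le> n" using range[OF e] by simp
    have B: "?B \<subseteq> U" using a b c e y by simp
    have "fst ` ?V = fst ` U - fst ` ?B" by (rule inj_on_image_set_diff[OF injs(1) _ B]) auto
    also have "fst ` ?B = {1..5}" by auto
    also have "fst ` U - {1..5} = {5+1..n}" unfolding fU by auto
    finally have f: "fst ` ?V = {5+1..n}" .
    have "snd ` ?V = snd ` U - snd ` ?B" by (rule inj_on_image_set_diff[OF injs(2) _ B]) auto
    also have "snd ` ?B = insert 6 {1..4}" by auto
    also have "snd ` U - insert 6 {1..4} = insert 5 {5+2..n}" using n6 unfolding sU by auto
    finally have s: "snd ` ?V = insert 5 {5+2..n}" .
    have "tail_state 5 n ?V"
      by (rule tail_state_remove[where U = U and k = 0 and z = "(3,6)"])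
        (use fin injs unc B f s deg in auto)
    from tail_state_classification[OF this] obtain w where
      w: "set w \<subseteq> {2,3}" "?V = set (tail_points 5 w)" by blast
    moreover have "U = ?B \<union> ?V" using B by auto
    ultimately have "U = set (chain_points w)" unfolding chain_points_def set_append w(2)[symmetric] by simp
    then show ?thesis using w b by blast
  next
    case 3
    then show ?thesis using b c same_pos[of 2 3 5] by auto
  next
    case 4
    note b = b[unfolded 4] and c = c[unfolded 4]
    have n5: "5 \<le> n" using range[OF c] by simp
    obtain pd where d: "(pd,3) \<in> U" using ex_val n5 by fastforce
    have "e \<notin> {1,2,4,5}" using same_val e a b c y by fastforce
    \<comment> \<open>A point on the diagonal has displacement 0, which is even.\<close>
    moreover have "e \<noteq> 3" by (cases rule: displacement_cases[OF disp[OF e] LR[OF e]]) simp_all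
    ultimately have "6 \<le> e" using range(3)[OF e] by auto
    then have "e = 6" by (cases rule: displacement_cases[OF disp[OF e] LR[OF e]]) simp_all
    note e = e[unfolded this]
    have "pd \<notin> {1,2,3,4,5}" using same_pos d a b c e y by fastforce
    then have "6 \<le> pd" using range(1)[OF d] by auto
    then have "pd = 6" by (cases rule: displacement_cases[OF disp[OF d] LR[OF d]]) simp_all
    note d = d[unfolded this]
    have "n = 6 \<and> U = set k33_points"
      by (rule closed) (use range[OF d] a b c d e y in \<open>auto simp: k33_points_def\<close>)
    then show ?thesis by simp
  qed
qed

lemma cubic_diagram_classification:
  assumes "cubic_diagram n U" "n > 0"
  obtains "n = 4" "U = set k4_points" | "n = 6" "U = set k33_points"
  | w where "set w \<subseteq> {2,3}" "U = set (chain_points w)"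
  | w where "set w \<subseteq> {2,3}" "U = prod.swap ` set (chain_points w)"
proof (cases "(3,2) \<in> U \<and> (2,3) \<notin> U")
  case False
  then show thesis using cubic_diagram_start[OF assms] that by blast
next
  case True
  let ?V = "prod.swap ` U"
  have V: "cubic_diagram n ?V" using assms by (simp add: cubic_diagram_swap)
  have "(2,3) \<in> ?V" "(3,2) \<notin> ?V" using True by force+
  then have "n = 4 \<and> ?V = set k4_points \<or> n = 6 \<and> ?V = set k33_points \<or>
    (\<exists>w. set w \<subseteq> {2,3} \<and> ?V = set (chain_points w))"
    using cubic_diagram_start[OF V assms(2)] by blast
  \<comment> \<open>The transposed diagram contains \<open>(2,3)\<close> but not
    \<open>(3,2)\<close>, which rules out both sporadic diagrams.\<close>
  moreover have "(3,2) \<in> set k4_points" "(2,3) \<notin> set k33_points"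
    by (simp_all add: k4_points_def k33_points_def)
  ultimately obtain w where "set w \<subseteq> {2,3}" "?V = set (chain_points w)"
    using \<open>(2,3) \<in> ?V\<close> \<open>(3,2) \<notin> ?V\<close> by blast
  moreover have "U = prod.swap ` ?V" by (simp add: image_image)
  ultimately show thesis using that(4) by metis
qed

section \<open>Chains of blocks\<close>

type_synonym block = "nat \<times> (nat \<times> nat) set"

text \<open>K4 without the edge between 0 and 3. In every piece the vertex meeting the incoming
  bridge is numbered 0 and the one meeting the outgoing bridge is numbered last.\<close>

definition diamond :: block where
  "diamond = (4, {(0,1), (0,2), (1,2), (1,3), (2,3)})"

text \<open>The sides of the bipartition are 0, 3, 4 and 1, 2, 5; the missing edge joins 0 and
  5.\<close>

definition k33_minus_edge :: block where
  "k33_minus_edge = (6, {(0,1), (0,2), (1,3), (1,4), (2,3), (2,4), (3,5), (4,5)})"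

text \<open>K4 on 0, 1, 2, 3 with the edge between 2 and 3 subdivided by vertex 4, which carries the
  bridge.\<close>

definition left_cap :: block where
  "left_cap = (5, {(0,1), (0,2), (0,3), (1,2), (1,3), (2,4), (3,4)})"

definition right_cap :: block where
  "right_cap = (5, {(0,1), (0,2), (1,3), (1,4), (2,3), (2,4), (3,4)})"

definition block_of :: "nat \<Rightarrow> block" where
  "block_of b = (if b = 2 then diamond else k33_minus_edge)"

definition chain_blocks :: "nat list \<Rightarrow> block list" where
  "chain_blocks w = left_cap # map block_of w @ [right_cap]"

lemmas block_defs = diamond_def k33_minus_edge_def left_cap_def right_cap_def

text \<open>Vertices are numbered consecutively through the blocks. The relation is meaningful only
  below \<open>total_size\<close>: it also joins the last vertex of the last block to the number
  after it.\<close>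

fun chain_adj :: "block list \<Rightarrow> nat \<Rightarrow> nat \<Rightarrow> bool" where
  "chain_adj [] i j \<longleftrightarrow> False"
| "chain_adj ((s, E) # Bs) i j \<longleftrightarrow>
    (if i < s \<and> j < s then (i, j) \<in> E \<or> (j, i) \<in> E
     else if i < s then i + 1 = s \<and> j = s
     else if j < s then j + 1 = s \<and> i = s
     else chain_adj Bs (i - s) (j - s))"

definition total_size :: "block list \<Rightarrow> nat" where
  "total_size Bs = sum_list (map fst Bs)"

lemma total_size_simps [simp]:
  "total_size [] = 0" "total_size (B # Bs) = fst B + total_size Bs"
  "total_size (As @ Bs) = total_size As + total_size Bs"
  by (simp_all add: total_size_def)

lemma chain_adj_append:
  "chain_adj (As @ Bs) i j \<longleftrightarrow>
    (let t = total_size As in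
     if i < t \<and> j < t then chain_adj As i j
     else if i < t then i + 1 = t \<and> j = t
     else if j < t then j + 1 = t \<and> i = t
     else chain_adj Bs (i - t) (j - t))"
proof (induction As arbitrary: i j)
  case Nil
  then show ?case by simp
next
  case (Cons A As)
  obtain s E where A: "A = (s, E)" by fastforce
  show ?case unfolding A by (auto simp: Cons.IH Let_def)
qed

text \<open>
  Exchanging the two ends of an edge makes every block literally equal to its mirror image, not only
  up to orientation of its edges.
\<close>

definition mirror :: "block \<Rightarrow> block" where
  "mirror B = (fst B, (\<lambda>(i, j). (fst B - 1 - j, fst B - 1 - i)) ` snd B)"

lemma total_size_mirror [simp]: "total_size (rev (map mirror Bs)) = total_size Bs"
  by (induction Bs) (simp_all add: mirror_def)

text \<open>The first block of the chain becomes the last of the mirrored one, so the induction step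
  splits off a block at the far end by \<open>chain_adj_append\<close>. Bounded blocks keep the
  truncated subtractions injective.\<close>

lemma chain_adj_mirror:
  assumes "\<forall>B\<in>set Bs. snd B \<subseteq> {..<fst B} \<times> {..<fst B}" "i < total_size Bs" "j < total_size Bs"
  shows "chain_adj (rev (map mirror Bs)) (total_size Bs - 1 - i) (total_size Bs - 1 - j)
    \<longleftrightarrow> chain_adj Bs i j"
  using assms
proof (induction Bs arbitrary: i j)
  case Nil
  then show ?case by simp
next
  case (Cons B Bs)
  obtain s E where B: "B = (s, E)" by fastforce
  have E: "E \<subseteq> {..<s} \<times> {..<s}" using Cons.prems(1) B by simp
  let ?t = "total_size Bs"
  have mem: "(s - Suc i, s - Suc j) \<in> (\<lambda>(i, j). (s - Suc j, s - Suc i)) ` E \<longleftrightarrow> (j, i) \<in> E"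
    if "i < s" "j < s" for i j
  proof
    assume "(s - Suc i, s - Suc j) \<in> (\<lambda>(i, j). (s - Suc j, s - Suc i)) ` E"
    then obtain i' j' where ij: "(i', j') \<in> E" "s - Suc i = s - Suc j'" "s - Suc j = s - Suc i'" by auto
    then have "i' < s" "j' < s" using E by auto
    then have "i' = j" "j' = i" using ij that by linarith+
    then show "(j, i) \<in> E" using ij by simp
  next
    assume "(j, i) \<in> E"
    then show "(s - Suc i, s - Suc j) \<in> (\<lambda>(i, j). (s - Suc j, s - Suc i)) ` E"
      by (rule rev_image_eqI) simp
  qed
  define t where "t = total_size Bs"
  define M where "M = rev (map mirror Bs)"
  define E' where "E' = (\<lambda>(i, j). (s - Suc j, s - Suc i)) ` E"
  have M: "total_size M = t" by (simp add: M_def t_def)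
  have split: "chain_adj (M @ [mirror B]) a b \<longleftrightarrow>
      (if a < t \<and> b < t then chain_adj M a b
       else if a < t then a + 1 = t \<and> b = t
       else if b < t then b + 1 = t \<and> a = t
       else chain_adj [(s, E')] (a - t) (b - t))" for a b
    by (simp add: chain_adj_append M Let_def mirror_def B E'_def)
  have ij: "i < s + t" "j < s + t" using Cons.prems B by (simp_all add: t_def)
  have "chain_adj (M @ [mirror B]) (s + t - 1 - i) (s + t - 1 - j) \<longleftrightarrow> chain_adj ((s, E) # Bs) i j"
  proof -
    consider "i < s" "j < s" | "i < s" "s \<le> j" | "s \<le> i" "j < s" | "s \<le> i" "s \<le> j" by linarith
    then show ?thesis
    proof cases
      case 1
      have eq: "s + t - 1 - i - t = s - Suc i" "s + t - 1 - j - t = s - Suc j" by auto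
      have ge: "\<not> s + t - 1 - i < t" "\<not> s + t - 1 - j < t" "s - Suc i < s" "s - Suc j < s" using 1 by auto
      show ?thesis
        unfolding split eq using ge 1 mem[of i j] mem[of j i] by (simp add: E'_def disj_commute)
    next
      case 2
      then show ?thesis unfolding split using ij by auto
    next
      case 3
      then show ?thesis unfolding split using ij by auto
    next
      case 4
      then have lt: "i - s < t" "j - s < t" using ij by auto
      have eq: "s + t - 1 - i = t - 1 - (i - s)" "s + t - 1 - j = t - 1 - (j - s)" using 4 by auto
      have "t - 1 - (i - s) < t" "t - 1 - (j - s) < t" using lt by auto
      moreover have "chain_adj M (t - 1 - (i - s)) (t - 1 - (j - s)) \<longleftrightarrow> chain_adj Bs (i - s) (j - s)"
        unfolding M_def t_def using lt Cons.prems(1) by (intro Cons.IH) (simp_all add: t_def)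
      ultimately show ?thesis unfolding split eq using 4 by simp
    qed
  qed
  then show ?case by (simp add: M_def t_def B)
qed

lemma mirror_blocks [simp]:
  "mirror left_cap = right_cap" "mirror right_cap = left_cap" "mirror (block_of b) = block_of b"
  by (auto simp: mirror_def block_defs block_of_def)

lemma mirror_chain_blocks: "rev (map mirror (chain_blocks w)) = chain_blocks (rev w)"
  by (simp add: chain_blocks_def rev_map[symmetric] comp_def)

lemma chain_blocks_bounded: "\<forall>B\<in>set (chain_blocks w). snd B \<subseteq> {..<fst B} \<times> {..<fst B}"
  by (auto simp: chain_blocks_def block_of_def block_defs split: if_splits)

lemma chain_size: 
  assumes "set w \<subseteq> {2,3}"
  shows "total_size (chain_blocks w) = 10 + 2 * sum_list w"
proof -
  have "total_size (map block_of w) = 2 * sum_list w"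
    using assms by (induction w) (auto simp: block_of_def block_defs)
  then show ?thesis by (simp add: chain_blocks_def block_defs)
qed

lemma chain_size_rev [simp]: "total_size (chain_blocks (rev w)) = total_size (chain_blocks w)"
  by (metis mirror_chain_blocks total_size_mirror)

lemma chain_adj_rev:
  assumes "i < total_size (chain_blocks w)" "j < total_size (chain_blocks w)"
  shows "chain_adj (chain_blocks (rev w)) (total_size (chain_blocks w) - 1 - i)
      (total_size (chain_blocks w) - 1 - j) \<longleftrightarrow> chain_adj (chain_blocks w) i j"
  using chain_adj_mirror[OF chain_blocks_bounded assms] unfolding mirror_chain_blocks .

lemma length_tail_points: "length (tail_points k w) = total_size (map block_of w @ [right_cap])"
  by (induction w arbitrary: k) (auto simp: block_of_def block_defs)

lemma tail_points_nth_0: "tail_points k w ! 0 = (k + 3, k)"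
  by (cases w) auto

text \<open>This separates the tail from what precedes it: apart from its first point, the tail lies
  entirely to the upper right of the earlier points.\<close>

lemma tail_points_nth_Suc:
  assumes "Suc i < length (tail_points k w)"
  shows "k < fst (tail_points k w ! Suc i)" "k + 1 < snd (tail_points k w ! Suc i)"
proof -
  have "tail_points k w \<noteq> [] \<and> (\<forall>u\<in>set (tl (tail_points k w)). k < fst u \<and> k + 1 < snd u)"
  proof (induction w arbitrary: k)
    case (Cons b w)
    \<comment> \<open>This weaker bound treats positions and values alike, so it survives the swap
      after a diamond; the shift of \<open>k\<close> by at least 4 makes up for the loss.\<close>
    have ge: "k' \<le> p \<and> k' \<le> q" if "(p,q) \<in> set (tail_points k' w)" for k' p q
      using Cons.IH[of k'] that tail_points_nth_0[of k' w]
      by (cases "tail_points k' w") auto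
    show ?case by (cases "b = 2") (auto dest!: ge)
  qed simp
  moreover have "tail_points k w ! Suc i \<in> set (tl (tail_points k w))"
    using assms nth_mem[of i "tl (tail_points k w)"] by (cases "tail_points k w") auto
  ultimately show "k < fst (tail_points k w ! Suc i)" "k + 1 < snd (tail_points k w ! Suc i)" by auto
qed

text \<open>One induction step for translating crossings into \<open>chain_adj\<close>: a block
  meets the rest of the list only in the crossing of its last point with the first point of the
  rest.\<close>

lemma crosses_block_append:
  assumes inner: "\<forall>i<length P. \<forall>j<length P. crosses (P ! i) (P ! j) \<longleftrightarrow> (i, j) \<in> E \<or> (j, i) \<in> E"
    and link: "\<forall>i<length P. crosses (P ! i) (R ! 0) \<longleftrightarrow> Suc i = length P"
    and far: "\<And>i j. i < length P \<Longrightarrow> Suc j < length R \<Longrightarrow> \<not> crosses (P ! i) (R ! Suc j)"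
    and rest: "\<And>i j. i < length R \<Longrightarrow> j < length R \<Longrightarrow> crosses (R ! i) (R ! j) \<longleftrightarrow> chain_adj Bs i j"
    and ij: "i < length (P @ R)" "j < length (P @ R)"
  shows "crosses ((P @ R) ! i) ((P @ R) ! j) \<longleftrightarrow> chain_adj ((length P, E) # Bs) i j"
proof -
  have PR: "crosses (P ! i) (R ! j) \<longleftrightarrow> Suc i = length P \<and> j = 0" if "i < length P" "j < length R" for i j
    using that link far by (cases j) auto
  consider "i < length P" "j < length P" | "i < length P" "length P \<le> j"
    | "length P \<le> i" "j < length P" | "length P \<le> i" "length P \<le> j" by linarith
  then show ?thesis
  proof cases
    case 1
    then show ?thesis using inner by (simp add: nth_append)
  next
    case 2
    then show ?thesis using ij PR[of i "j - length P"] by (auto simp: nth_append)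
  next
    case 3
    then show ?thesis using ij PR[of j "i - length P"]
      by (auto simp: nth_append crosses_sym[of "R ! (i - length P)"])
  next
    case 4
    then show ?thesis using ij rest[of "i - length P" "j - length P"] by (simp add: nth_append)
  qed
qed

text \<open>Unrolls a quantifier over the indices of an explicit list into finitely many cases to be
  evaluated.\<close>

lemma less_length_Cons_iff: "(\<forall>i<length (x # xs). Q i) \<longleftrightarrow> Q 0 \<and> (\<forall>i<length xs. Q (Suc i))"
  by (auto simp: less_Suc_eq_0_disj)

lemma crosses_tail_points:
  assumes "i < length (tail_points k w)" "j < length (tail_points k w)"
  shows "crosses (tail_points k w ! i) (tail_points k w ! j)
    \<longleftrightarrow> chain_adj (map block_of w @ [right_cap]) i j"
  using assms
proof (induction w arbitrary: k i j)
  case Nil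
  have "\<forall>i<length (tail_points k []). \<forall>j<length (tail_points k []).
     crosses (tail_points k [] ! i) (tail_points k [] ! j) \<longleftrightarrow> chain_adj [right_cap] i j"
    unfolding tail_points.simps less_length_Cons_iff right_cap_def
    by (simp add: crosses_def)
  then show ?case using Nil by simp
next
  case (Cons b w)
  show ?case
  proof (cases "b = 2")
    case True
    let ?P = "[(k+3,k), (k+1,k+4), (k+2,k+3), (k+5,k+2)]"
    let ?R = "map prod.swap (tail_points (k+4) w)"
    have pts: "tail_points k (b # w) = ?P @ ?R" using True by simp
    have pos: "0 < length (tail_points (k+4) w)" by (simp add: length_tail_points block_defs)
    have blk: "map block_of (b # w) @ [right_cap] = (length ?P, snd diamond) # map block_of w @ [right_cap]"
      using True by (simp add: block_of_def diamond_def)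
    show ?thesis
      unfolding blk pts
    proof (rule crosses_block_append)
      show "\<forall>i<length ?P. \<forall>j<length ?P. crosses (?P ! i) (?P ! j) \<longleftrightarrow>
          (i, j) \<in> snd diamond \<or> (j, i) \<in> snd diamond"
        unfolding less_length_Cons_iff by (simp add: crosses_def diamond_def)
      show "\<forall>i<length ?P. crosses (?P ! i) (?R ! 0) \<longleftrightarrow> Suc i = length ?P"
        unfolding less_length_Cons_iff using pos
        by (simp add: tail_points_nth_0[unfolded One_nat_def] crosses_def)
      show "\<not> crosses (?P ! i) (?R ! Suc j)" if "i < length ?P" "Suc j < length ?R" for i j
      proof -
        have j: "Suc j < length (tail_points (k+4) w)" using that by simp
        have "\<forall>i<length ?P. \<not> crosses (?P ! i) (?R ! Suc j)"
          unfolding less_length_Cons_iff using tail_points_nth_Suc[OF j] j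
          by (simp add: crosses_def)
        then show ?thesis using that by blast
      qed
      \<comment> \<open>Crossing is invariant under transposition, so the induction hypothesis
        covers the swapped tail.\<close>
      show "crosses (?R ! i) (?R ! j) \<longleftrightarrow> chain_adj (map block_of w @ [right_cap]) i j"
        if "i < length ?R" "j < length ?R" for i j
        using Cons.IH[of i "k+4" j] that by simp
    qed (use Cons.prems pts in simp_all)
  next
    case False
    let ?P = "[(k+3,k), (k+1,k+4), (k+2,k+5), (k+5,k+2), (k+6,k+3), (k+4,k+7)]"
    let ?R = "tail_points (k+6) w"
    have pts: "tail_points k (b # w) = ?P @ ?R" using False by simp
    have blk: "map block_of (b # w) @ [right_cap] = (length ?P, snd k33_minus_edge) # map block_of w @ [right_cap]"
      using False by (simp add: block_of_def k33_minus_edge_def)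
    show ?thesis
      unfolding blk pts
    proof (rule crosses_block_append)
      show "\<forall>i<length ?P. \<forall>j<length ?P. crosses (?P ! i) (?P ! j) \<longleftrightarrow>
          (i, j) \<in> snd k33_minus_edge \<or> (j, i) \<in> snd k33_minus_edge"
        unfolding less_length_Cons_iff by (simp add: crosses_def k33_minus_edge_def)
      show "\<forall>i<length ?P. crosses (?P ! i) (?R ! 0) \<longleftrightarrow> Suc i = length ?P"
        unfolding less_length_Cons_iff
        by (simp add: tail_points_nth_0[unfolded One_nat_def] crosses_def)
      show "\<not> crosses (?P ! i) (?R ! Suc j)" if "i < length ?P" "Suc j < length ?R" for i j
      proof -
        have "\<forall>i<length ?P. \<not> crosses (?P ! i) (?R ! Suc j)"
          unfolding less_length_Cons_iff using tail_points_nth_Suc[OF that(2)]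
          by (simp add: crosses_def)
        then show ?thesis using that by blast
      qed
      show "crosses (?R ! i) (?R ! j) \<longleftrightarrow> chain_adj (map block_of w @ [right_cap]) i j"
        if "i < length ?R" "j < length ?R" for i j
        using Cons.IH[of i "k+6" j] that by simp
    qed (use Cons.prems pts in simp_all)
  qed
qed

lemma length_chain_points: "length (chain_points w) = total_size (chain_blocks w)"
  by (simp add: chain_points_def chain_blocks_def length_tail_points left_cap_def)

lemma crosses_chain_points:
  assumes "i < length (chain_points w)" "j < length (chain_points w)"
  shows "crosses (chain_points w ! i) (chain_points w ! j) \<longleftrightarrow> chain_adj (chain_blocks w) i j"
proof -
  let ?P = "[(1,4), (2,3), (4,1), (5,2), (3,6)] :: (nat \<times> nat) list"
  let ?R = "tail_points 5 w"
  have blk: "chain_blocks w = (length ?P, snd left_cap) # map block_of w @ [right_cap]"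
    by (simp add: chain_blocks_def left_cap_def)
  show ?thesis
    unfolding blk chain_points_def
  proof (rule crosses_block_append)
    show "\<forall>i<length ?P. \<forall>j<length ?P. crosses (?P ! i) (?P ! j) \<longleftrightarrow>
        (i, j) \<in> snd left_cap \<or> (j, i) \<in> snd left_cap"
      unfolding less_length_Cons_iff by (simp add: crosses_def left_cap_def)
    show "\<forall>i<length ?P. crosses (?P ! i) (?R ! 0) \<longleftrightarrow> Suc i = length ?P"
      unfolding less_length_Cons_iff
      by (simp add: tail_points_nth_0[unfolded One_nat_def] crosses_def)
    show "\<not> crosses (?P ! i) (?R ! Suc j)" if "i < length ?P" "Suc j < length ?R" for i j
    proof -
      have "\<forall>i<length ?P. \<not> crosses (?P ! i) (?R ! Suc j)"
        unfolding less_length_Cons_iff using tail_points_nth_Suc[OF that(2)]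
        by (simp add: crosses_def)
      then show ?thesis using that by blast
    qed
  qed (use assms crosses_tail_points in \<open>simp_all add: chain_points_def\<close>)
qed

lemma image_tail_points:
  "fst ` set (tail_points k w) = {k+1..k + length (tail_points k w)}"
  "snd ` set (tail_points k w) = insert k {k+2..k + length (tail_points k w)}"
proof -
  have "fst ` set (tail_points k w) = {k+1..k + length (tail_points k w)} \<and>
    snd ` set (tail_points k w) = insert k {k+2..k + length (tail_points k w)}"
  proof (induction w arbitrary: k)
    case Nil
    show ?case by auto
  next
    case (Cons b w)
    define m where "m = length (tail_points k (b # w))"
    have "fst ` set (tail_points k (b # w)) = {k+1..k+m} \<and> snd ` set (tail_points k (b # w)) = insert k {k+2..k+m}"
    proof (cases "b = 2")
      case True
      have sw: "fst ` prod.swap ` A = snd ` A" "snd ` prod.swap ` A = fst ` A" for A :: "(nat \<times> nat) set"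
        by force+
      \<comment> \<open>That the tail is nonempty matters: the diamond itself already uses position
        \<open>k + 5\<close>, which must not exceed \<open>k + 4 + l\<close>.\<close>
      obtain l where l: "length (tail_points (k+4) w) = l" "0 < l"
        by (simp add: length_tail_points block_defs)
      then have "m = 4 + l" using True by (simp add: m_def)
      then show ?thesis
        using True l(2) by (auto simp: l(1) image_Un sw Cons.IH)
    next
      case False
      obtain l where l: "length (tail_points (k+6) w) = l" "0 < l"
        by (simp add: length_tail_points block_defs)
      then have "m = 6 + l" using False by (simp add: m_def)
      then show ?thesis
        using False l(2) by (auto simp: l(1) image_Un Cons.IH)
    qed
    then show ?case by (simp add: m_def)
  qed
  then show "fst ` set (tail_points k w) = {k+1..k + length (tail_points k w)}"
    "snd ` set (tail_points k w) = insert k {k+2..k + length (tail_points k w)}" by auto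
qed

lemma image_chain_points:
  "fst ` set (chain_points w) = {1..length (chain_points w)}"
  "snd ` set (chain_points w) = {1..length (chain_points w)}"
proof -
  define m where "m = length (tail_points 5 w)"
  have "0 < m" by (simp add: m_def length_tail_points block_defs)
  have l: "length (chain_points w) = 5 + m" by (simp add: chain_points_def m_def)
  have "fst ` set (chain_points w) = {1,2,3,4,5} \<union> {5+1..5+m}"
    unfolding m_def by (auto simp add: chain_points_def image_Un image_tail_points)
  also have "\<dots> = {1..5+m}" by auto
  finally show "fst ` set (chain_points w) = {1..length (chain_points w)}" using l by simp
  have "snd ` set (chain_points w) = {1,2,3,4,6} \<union> insert 5 {5+2..5+m}"
    unfolding m_def by (auto simp add: chain_points_def image_Un image_tail_points)
  also have "\<dots> = {1..5+m}" using \<open>0 < m\<close> by auto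
  finally show "snd ` set (chain_points w) = {1..length (chain_points w)}" using l by simp
qed

section \<open>Recovering the composition from the graph\<close>

text \<open>The two bounds discard the spurious adjacency of \<open>chain_adj\<close> just beyond
  the last vertex.\<close>

definition nbrs :: "block list \<Rightarrow> nat \<Rightarrow> nat set" where
  "nbrs Bs i = {j. i < total_size Bs \<and> j < total_size Bs \<and> chain_adj Bs i j}"

lemma nbrs_block:
  assumes "E \<subseteq> {..<s} \<times> {..<s}" "i < s"
  shows "nbrs (As @ (s, E) # Cs) (total_size As + i) =
      (+) (total_size As) ` {j. (i, j) \<in> E \<or> (j, i) \<in> E}
      \<union> (if i = 0 \<and> 0 < total_size As then {total_size As - 1} else {})
      \<union> (if Suc i = s \<and> 0 < total_size Cs then {total_size As + s} else {})"
    (is "?L = ?R")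
proof (rule set_eqI)
  fix v
  let ?o = "total_size As"
  consider "v < ?o" | j where "v = ?o + j" "j < s" | j where "v = ?o + s + j"
    by (metis add.assoc le_Suc_ex less_add_eq_less not_less nat_add_left_cancel_less)
  then show "v \<in> ?L \<longleftrightarrow> v \<in> ?R"
  proof cases
    case 1
    then show ?thesis using assms by (auto simp: nbrs_def chain_adj_append Let_def)
  next
    case (2 j)
    then show ?thesis using assms by (auto simp: nbrs_def chain_adj_append Let_def)
  next
    case (3 j)
    have "(i, s + j) \<notin> E" "(s + j, i) \<notin> E" using assms by auto
    then show ?thesis using 3 assms by (auto simp: nbrs_def chain_adj_append Let_def add.assoc)
  qed
qed

text \<open>
  The next three predicates describe, in terms of the neighbourhoods alone, the piece entered along the
  edge from \<open>x\<close> to \<open>y\<close>; it is left along the edge from \<open>z\<close> to \<open>x'\<close>.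
\<close>

definition cap_at :: "('a \<Rightarrow> 'a set) \<Rightarrow> 'a \<Rightarrow> 'a \<Rightarrow> bool" where
  "cap_at N x y \<longleftrightarrow> (let T = N y - {x} in T \<noteq> {} \<and> (\<forall>a\<in>T. N a \<inter> T = {}) \<and>
     (\<exists>C. y \<notin> C \<and> (\<forall>a\<in>T. N a = insert y C) \<and> (\<exists>c\<in>C. N c \<inter> C \<noteq> {})))"

definition diamond_at :: "('a \<Rightarrow> 'a set) \<Rightarrow> 'a \<Rightarrow> 'a \<Rightarrow> 'a \<Rightarrow> 'a \<Rightarrow> bool" where
  "diamond_at N x y z x' \<longleftrightarrow> (let T = N y - {x} in (\<exists>a\<in>T. N a \<inter> T \<noteq> {}) \<and>
     (\<forall>a\<in>T. insert a (N a) = insert y (insert z T)) \<and> y \<noteq> z \<and> y \<notin> T \<and> z \<notin> T \<and>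
     x' \<notin> T \<and> N z = insert x' T)"

definition k33_at :: "('a \<Rightarrow> 'a set) \<Rightarrow> 'a \<Rightarrow> 'a \<Rightarrow> 'a \<Rightarrow> 'a \<Rightarrow> bool" where
  "k33_at N x y z x' \<longleftrightarrow> (let T = N y - {x} in T \<noteq> {} \<and> (\<forall>a\<in>T. N a \<inter> T = {}) \<and>
     (\<exists>C. y \<notin> C \<and> C \<noteq> {} \<and> (\<forall>a\<in>T. N a = insert y C) \<and> (\<forall>c\<in>C. N c \<inter> C = {}) \<and>
       (\<forall>c\<in>C. N c = insert z T) \<and> z \<notin> T \<and> x' \<notin> C \<and> N z = insert x' C))"

lemma diamond_atD:
  assumes "diamond_at N x y z x'"
  shows "\<exists>a\<in>N y - {x}. N a \<inter> (N y - {x}) \<noteq> {}"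
    "\<forall>a\<in>N y - {x}. insert a (N a) = insert y (insert z (N y - {x}))"
    "y \<noteq> z" "y \<notin> N y - {x}" "z \<notin> N y - {x}" "x' \<notin> N y - {x}" "N z = insert x' (N y - {x})"
  using assms unfolding diamond_at_def Let_def by - (elim conjE, assumption)+

lemma cap_atD:
  assumes "cap_at N x y"
  shows "N y - {x} \<noteq> {}" "\<forall>a\<in>N y - {x}. N a \<inter> (N y - {x}) = {}"
    "\<exists>C. y \<notin> C \<and> (\<forall>a\<in>N y - {x}. N a = insert y C) \<and> (\<exists>c\<in>C. N c \<inter> C \<noteq> {})"
  using assms unfolding cap_at_def Let_def by - (elim conjE, assumption)+

lemma k33_atD:
  assumes "k33_at N x y z x'"
  shows "N y - {x} \<noteq> {}" "\<forall>a\<in>N y - {x}. N a \<inter> (N y - {x}) = {}"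
    "\<exists>C. y \<notin> C \<and> C \<noteq> {} \<and> (\<forall>a\<in>N y - {x}. N a = insert y C) \<and> (\<forall>c\<in>C. N c \<inter> C = {}) \<and>
       (\<forall>c\<in>C. N c = insert z (N y - {x})) \<and> z \<notin> N y - {x} \<and> x' \<notin> C \<and> N z = insert x' C"
  using assms unfolding k33_at_def Let_def by - (elim conjE, assumption)+

lemma insert_eq_notin:
  assumes "insert a A = insert b A" "a \<notin> A" "b \<notin> A"
  shows "a = b"
  using assms by (metis insertE insertI1)

text \<open>The closed neighbourhood of a vertex of T consists of T, \<open>y\<close> and
  \<open>z\<close>, which gives \<open>z\<close>; then \<open>N z\<close> exceeds T by
  \<open>x'\<close> alone.\<close>

lemma diamond_at_unique:
  assumes "diamond_at N x y z x'" "diamond_at N x y u u'"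
  shows "z = u" "x' = u'"
proof -
  note D = diamond_atD[OF assms(1)] and D' = diamond_atD[OF assms(2)]
  define T where "T = N y - {x}"
  note D = D[folded T_def] and D' = D'[folded T_def]
  obtain a where a: "a \<in> T" using D(1) by (rule bexE)
  have "insert z (insert y T) = insert u (insert y T)"
    using bspec[OF D(2) a] bspec[OF D'(2) a] by (simp add: insert_commute)
  then show zu: "z = u" by (rule insert_eq_notin) (use D(3,5) D'(3,5) in auto)
  have "insert x' T = insert u' T" using D(7) D'(7) zu by simp
  then show "x' = u'" using D(6) D'(6) by (rule insert_eq_notin)
qed

text \<open>The existentially bound set C is no freedom: it is \<open>N a\<close> without
  \<open>y\<close> for any \<open>a\<close> in the nonempty set T. Then \<open>N c\<close> for some
  \<open>c\<close> in C yields \<open>z\<close>, and \<open>N z\<close> yields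
  \<open>x'\<close>.\<close>

lemma k33_at_unique:
  assumes "k33_at N x y z x'" "k33_at N x y u u'"
  shows "z = u" "x' = u'"
proof -
  note D = k33_atD[OF assms(1)] and D' = k33_atD[OF assms(2)]
  define T where "T = N y - {x}"
  note D = D[folded T_def] and D' = D'[folded T_def]
  obtain a where a: "a \<in> T" using D(1) by auto
  from D(3) obtain C where C: "y \<notin> C" "C \<noteq> {}" "\<forall>a\<in>T. N a = insert y C" "\<forall>c\<in>C. N c = insert z T"
      "z \<notin> T" "x' \<notin> C" "N z = insert x' C"
    by (elim exE conjE) (rule that)
  from D'(3) obtain D where D: "y \<notin> D" "\<forall>a\<in>T. N a = insert y D" "\<forall>c\<in>D. N c = insert u T"
      "u \<notin> T" "u' \<notin> D" "N u = insert u' D"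
    by (elim exE conjE) (rule that)
  have CD: "C = D" using bspec[OF C(3) a] bspec[OF D(2) a] C(1) D(1) by (metis insert_ident)
  obtain c where c: "c \<in> C" using C(2) by auto
  have "insert z T = insert u T" using bspec[OF C(4) c] bspec[OF D(3) c[unfolded CD]] by simp
  then show zu: "z = u" using C(5) D(4) by (rule insert_eq_notin)
  have "insert x' C = insert u' C" using C(7) D(6) CD zu by simp
  then show "x' = u'" using C(6) D(5) unfolding CD by (rule insert_eq_notin)
qed

lemma diamond_at_not_cap_at: "diamond_at N x y z x' \<Longrightarrow> \<not> cap_at N x y"
  using diamond_atD(1) cap_atD(2) by metis

lemma diamond_at_not_k33_at: "diamond_at N x y z x' \<Longrightarrow> \<not> k33_at N x y u u'"
  using diamond_atD(1) k33_atD(2) by metis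

text \<open>Both predicates determine the same C, which contains an edge in a cap and none in the
  block.\<close>

lemma k33_at_not_cap_at:
  assumes "k33_at N x y z x'"
  shows "\<not> cap_at N x y"
proof
  assume "cap_at N x y"
  note D = k33_atD[OF assms] and D' = cap_atD[OF this]
  obtain a where a: "a \<in> N y - {x}" using D(1) by auto
  from D(3) obtain C where C: "y \<notin> C" "\<forall>a\<in>N y - {x}. N a = insert y C" "\<forall>c\<in>C. N c \<inter> C = {}"
    by (elim exE conjE) (rule that)
  from D'(3) obtain D where D: "y \<notin> D" "\<forall>a\<in>N y - {x}. N a = insert y D" "\<exists>c\<in>D. N c \<inter> D \<noteq> {}"
    by (elim exE conjE) (rule that)
  have "C = D" using bspec[OF C(2) a] bspec[OF D(2) a] C(1) D(1) by (metis insert_ident)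
  then show False using C(3) D(3) by auto
qed

lemmas at_exclusive = diamond_at_not_cap_at diamond_at_not_k33_at k33_at_not_cap_at

text \<open>The walk along the chain starting with the edge from \<open>x\<close> to
  \<open>y\<close>. It is a relation because the exit edge of a piece is described, not computed;
  \<open>reads_deterministic\<close> makes up for this.\<close>

inductive reads :: "('a \<Rightarrow> 'a set) \<Rightarrow> 'a \<Rightarrow> 'a \<Rightarrow> nat list \<Rightarrow> bool" for N where
  cap: "cap_at N x y \<Longrightarrow> reads N x y []"
| diamond: "diamond_at N x y z x' \<Longrightarrow> reads N z x' w \<Longrightarrow> reads N x y (2 # w)"
| k33: "k33_at N x y z x' \<Longrightarrow> reads N z x' w \<Longrightarrow> reads N x y (3 # w)"

lemma reads_deterministic:
  assumes "reads N x y w" "reads N x y v"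
  shows "w = v"
  using assms
proof (induction arbitrary: v rule: reads.induct)
  case (cap x y)
  from cap(2) show ?case
    by cases (use cap(1) at_exclusive in \<open>metis+\<close>)
next
  case (diamond x y z x' w)
  from diamond.prems show ?case
  proof cases
    case (diamond u u' v')
    then show ?thesis using diamond_at_unique[OF \<open>diamond_at N x y z x'\<close>] diamond.IH by metis
  qed (use diamond.hyps at_exclusive in metis)+
next
  case (k33 x y z x' w)
  from k33.prems show ?case
  proof cases
    case (k33 u u' v')
    then show ?thesis using k33_at_unique[OF \<open>k33_at N x y z x'\<close>] k33.IH by metis
  qed (use k33.hyps at_exclusive in metis)+
qed

text \<open>Images under a map injective on the whole type commute with difference and intersection,
  so every clause of the three predicates transports. Isomorphisms are therefore extended to all
  vertex numbers before use.\<close>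

lemma reads_iso:
  assumes f: "inj f" and N': "\<And>v. N' (f v) = f ` N v" and "reads N x y w"
  shows "reads N' (f x) (f y) w"
proof -
  have T: "N' (f y) - {f x} = f ` (N y - {x})" for x y
    using image_set_diff[OF f, of "N y" "{x}"] by (simp add: N')
  have int: "f ` A \<inter> f ` B = {} \<longleftrightarrow> A \<inter> B = {}" for A B
    by (simp add: image_Int[OF f, symmetric])
  have ins: "insert (f a) (f ` A) = f ` insert a A" for a A by simp
  note eqs = T N' int ins inj_image_eq_iff[OF f] inj_image_mem_iff[OF f] inj_eq[OF f]
    ball_simps bex_simps image_is_empty
  show ?thesis
    using assms(3)
  proof (induction rule: reads.induct)
    case (cap x y)
    note D = cap_atD[OF this]
    define T where "T = N y - {x}"
    from D(3)[folded T_def] obtain C where C: "y \<notin> C" "\<forall>a\<in>T. N a = insert y C" "\<exists>c\<in>C. N c \<inter> C \<noteq> {}"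
      by (elim exE conjE) (rule that)
    have "cap_at N' (f x) (f y)"
      unfolding cap_at_def Let_def T T_def[symmetric]
    proof (intro conjI exI[of _ "f ` C"])
      show "f ` T \<noteq> {}" "\<forall>a\<in>f ` T. N' a \<inter> f ` T = {}"
        using D(1,2) by (simp_all only: eqs T_def not_False_eq_True)
      show "f y \<notin> f ` C" "\<forall>a\<in>f ` T. N' a = insert (f y) (f ` C)" "\<exists>c\<in>f ` C. N' c \<inter> f ` C \<noteq> {}"
        using C by (simp_all only: eqs not_False_eq_True)
    qed
    then show ?case by (rule reads.cap)
  next
    case (diamond x y z x' w)
    note D = diamond_atD[OF diamond.hyps(1)]
    have "diamond_at N' (f x) (f y) (f z) (f x')"
      unfolding diamond_at_def Let_def T
      by (intro conjI) (use D in \<open>simp_all only: eqs not_False_eq_True\<close>)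
    then show ?case using diamond.IH by (rule reads.diamond)
  next
    case (k33 x y z x' w)
    note D = k33_atD[OF k33.hyps(1)]
    define T where "T = N y - {x}"
    from D(3)[folded T_def] obtain C where C: "y \<notin> C" "C \<noteq> {}" "\<forall>a\<in>T. N a = insert y C" "\<forall>c\<in>C. N c \<inter> C = {}"
      "\<forall>c\<in>C. N c = insert z T" "z \<notin> T" "x' \<notin> C" "N z = insert x' C"
      by (elim exE conjE) (rule that)
    have "k33_at N' (f x) (f y) (f z) (f x')"
      unfolding k33_at_def Let_def T T_def[symmetric]
    proof (intro conjI exI[of _ "f ` C"])
      show "f ` T \<noteq> {}" "\<forall>a\<in>f ` T. N' a \<inter> f ` T = {}"
        using D(1,2) by (simp_all only: eqs T_def not_False_eq_True)
      show "f y \<notin> f ` C" "f ` C \<noteq> {}" "\<forall>a\<in>f ` T. N' a = insert (f y) (f ` C)"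
        "\<forall>c\<in>f ` C. N' c \<inter> f ` C = {}" "\<forall>c\<in>f ` C. N' c = insert (f z) (f ` T)" "f z \<notin> f ` T"
        "f x' \<notin> f ` C" "N' (f z) = insert (f x') (f ` C)"
        using C by (simp_all only: eqs not_False_eq_True)
    qed
    then show ?case using k33.IH by (rule reads.k33)
  qed
qed

text \<open>The earlier pieces occupy the numbers up to \<open>p\<close>, so \<open>p\<close> is the
  near end of the incoming bridge and the block starts at \<open>p + 1\<close>. All tables below use
  these coordinates.\<close>

lemma nbrs_blockI:
  assumes "B = (s, E)" "E \<subseteq> {..<s} \<times> {..<s}" "total_size As = Suc p" "0 < total_size Cs" "i < s"
    and "v = Suc p + i"
    and "{j. (i, j) \<in> E \<or> (j, i) \<in> E} = S"
  shows "nbrs (As @ B # Cs) v =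
      (+) (Suc p) ` S \<union> (if i = 0 then {p} else {}) \<union> (if Suc i = s then {Suc p + s} else {})"
  using nbrs_block[OF assms(2,5), of As Cs] assms(3,4)
  unfolding assms(1,6,7) by (simp only: simp_thms diff_Suc_1 zero_less_Suc)

lemma nbrs_diamond:
  assumes "total_size As = Suc p" "0 < total_size Cs"
  shows "nbrs (As @ diamond # Cs) (p+1) = {p, p+2, p+3}"
    "nbrs (As @ diamond # Cs) (p+2) = {p+1, p+3, p+4}"
    "nbrs (As @ diamond # Cs) (p+3) = {p+1, p+2, p+4}"
    "nbrs (As @ diamond # Cs) (p+4) = {p+2, p+3, p+5}"
proof -
  note I = nbrs_blockI[OF diamond_def _ assms]
  show "nbrs (As @ diamond # Cs) (p+1) = {p, p+2, p+3}"
    by (subst I[where i = 0 and S = "{1,2}"]) auto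
  show "nbrs (As @ diamond # Cs) (p+2) = {p+1, p+3, p+4}"
    by (subst I[where i = 1 and S = "{0,2,3}"]) auto
  show "nbrs (As @ diamond # Cs) (p+3) = {p+1, p+2, p+4}"
    by (subst I[where i = 2 and S = "{0,1,3}"]) auto
  show "nbrs (As @ diamond # Cs) (p+4) = {p+2, p+3, p+5}"
    by (subst I[where i = 3 and S = "{1,2}"]) auto
qed

lemma nbrs_k33:
  assumes "total_size As = Suc p" "0 < total_size Cs"
  shows "nbrs (As @ k33_minus_edge # Cs) (p+1) = {p, p+2, p+3}"
    "nbrs (As @ k33_minus_edge # Cs) (p+2) = {p+1, p+4, p+5}"
    "nbrs (As @ k33_minus_edge # Cs) (p+3) = {p+1, p+4, p+5}"
    "nbrs (As @ k33_minus_edge # Cs) (p+4) = {p+2, p+3, p+6}"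
    "nbrs (As @ k33_minus_edge # Cs) (p+5) = {p+2, p+3, p+6}"
    "nbrs (As @ k33_minus_edge # Cs) (p+6) = {p+4, p+5, p+7}"
proof -
  note I = nbrs_blockI[OF k33_minus_edge_def _ assms]
  show "nbrs (As @ k33_minus_edge # Cs) (p+1) = {p, p+2, p+3}"
    by (subst I[where i = 0 and S = "{1,2}"]) auto
  show "nbrs (As @ k33_minus_edge # Cs) (p+2) = {p+1, p+4, p+5}"
    by (subst I[where i = 1 and S = "{0,3,4}"]) auto
  show "nbrs (As @ k33_minus_edge # Cs) (p+3) = {p+1, p+4, p+5}"
    by (subst I[where i = 2 and S = "{0,3,4}"]) auto
  show "nbrs (As @ k33_minus_edge # Cs) (p+4) = {p+2, p+3, p+6}"
    by (subst I[where i = 3 and S = "{1,2,5}"]) auto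
  show "nbrs (As @ k33_minus_edge # Cs) (p+5) = {p+2, p+3, p+6}"
    by (subst I[where i = 4 and S = "{1,2,5}"]) auto
  show "nbrs (As @ k33_minus_edge # Cs) (p+6) = {p+4, p+5, p+7}"
    by (subst I[where i = 5 and S = "{3,4}"]) auto
qed

lemma nbrs_right_cap:
  assumes "total_size As = Suc p"
  shows "nbrs (As @ [right_cap]) (p+1) = {p, p+2, p+3}"
    "nbrs (As @ [right_cap]) (p+2) = {p+1, p+4, p+5}"
    "nbrs (As @ [right_cap]) (p+3) = {p+1, p+4, p+5}"
    "nbrs (As @ [right_cap]) (p+4) = {p+2, p+3, p+5}"
    "nbrs (As @ [right_cap]) (p+5) = {p+2, p+3, p+4}"
proof -
  have I: "nbrs (As @ [right_cap]) v = (+) (Suc p) ` S \<union> (if i = 0 then {p} else {})"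
    if "i < 5" "v = Suc p + i" "{j. (i, j) \<in> snd right_cap \<or> (j, i) \<in> snd right_cap} = S" for v i S
    using nbrs_block[of "snd right_cap" 5 i As "[]"] that assms by (simp add: right_cap_def)
  show "nbrs (As @ [right_cap]) (p+1) = {p, p+2, p+3}"
    by (subst I[where i = 0 and S = "{1,2}"]) (auto simp: right_cap_def)
  show "nbrs (As @ [right_cap]) (p+2) = {p+1, p+4, p+5}"
    by (subst I[where i = 1 and S = "{0,3,4}"]) (auto simp: right_cap_def)
  show "nbrs (As @ [right_cap]) (p+3) = {p+1, p+4, p+5}"
    by (subst I[where i = 2 and S = "{0,3,4}"]) (auto simp: right_cap_def)
  show "nbrs (As @ [right_cap]) (p+4) = {p+2, p+3, p+5}"
    by (subst I[where i = 3 and S = "{1,2,4}"]) (auto simp: right_cap_def)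
  show "nbrs (As @ [right_cap]) (p+5) = {p+2, p+3, p+4}"
    by (subst I[where i = 4 and S = "{1,2,3}"]) (auto simp: right_cap_def)
qed

lemma nbrs_left_cap:
  assumes "0 < total_size Cs"
  shows "nbrs (left_cap # Cs) 0 = {1, 2, 3}" "nbrs (left_cap # Cs) 1 = {0, 2, 3}"
    "nbrs (left_cap # Cs) 2 = {0, 1, 4}" "nbrs (left_cap # Cs) 3 = {0, 1, 4}"
    "nbrs (left_cap # Cs) 4 = {2, 3, 5}"
proof -
  have I: "nbrs (left_cap # Cs) i = S \<union> (if i = 4 then {5} else {})"
    if "i < 5" "{j. (i, j) \<in> snd left_cap \<or> (j, i) \<in> snd left_cap} = S" for i S
    using nbrs_block[of "snd left_cap" 5 i "[]" Cs] that assms by (auto simp: left_cap_def)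
  show "nbrs (left_cap # Cs) 0 = {1, 2, 3}"
    by (subst I[where S = "{1,2,3}"]) (auto simp: left_cap_def)
  show "nbrs (left_cap # Cs) 1 = {0, 2, 3}"
    by (subst I[where S = "{0,2,3}"]) (auto simp: left_cap_def)
  show "nbrs (left_cap # Cs) 2 = {0, 1, 4}"
    by (subst I[where S = "{0,1,4}"]) (auto simp: left_cap_def)
  show "nbrs (left_cap # Cs) 3 = {0, 1, 4}"
    by (subst I[where S = "{0,1,4}"]) (auto simp: left_cap_def)
  show "nbrs (left_cap # Cs) 4 = {2, 3, 5}"
    by (subst I[where S = "{2,3}"]) (auto simp: left_cap_def)
qed

text \<open>The prefix \<open>As\<close> is arbitrary so that a piece, once read, can be moved to
  its end in the induction.\<close>

lemma reads_chain:
  assumes "set w \<subseteq> {2,3}" "total_size As = Suc p"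
  shows "reads (nbrs (As @ map block_of w @ [right_cap])) p (p+1) w"
  using assms
proof (induction w arbitrary: As p)
  case Nil
  note N = nbrs_right_cap[OF Nil(2)]
  have T: "nbrs (As @ [right_cap]) (p+1) - {p} = {p+2,p+3}" unfolding N by auto
  have "cap_at (nbrs (As @ [right_cap])) p (p+1)"
    unfolding cap_at_def Let_def T by (intro conjI exI[of _ "{p+4,p+5}"]) (simp_all add: N del: add_2_eq_Suc')
  then show ?case by (auto intro: reads.cap)
next
  case (Cons b w)
  let ?R = "map block_of w @ [right_cap]"
  have R: "0 < total_size ?R" by (simp add: right_cap_def)
  show ?case
  proof (cases "b = 2")
    case True
    then have eq: "As @ map block_of (b # w) @ [right_cap] = As @ diamond # ?R" by (simp add: block_of_def)
    note N = nbrs_diamond[OF Cons.prems(2) R]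
    have T: "nbrs (As @ diamond # ?R) (p+1) - {p} = {p+2,p+3}" unfolding N by auto
    have "diamond_at (nbrs (As @ diamond # ?R)) p (p+1) (p+4) (p+5)"
      unfolding diamond_at_def Let_def T by (intro conjI) (simp_all add: N insert_commute del: add_2_eq_Suc')
    moreover have "reads (nbrs ((As @ [diamond]) @ ?R)) (p+4) (p+4+1) w"
      by (rule Cons.IH) (use Cons.prems in \<open>auto simp: diamond_def\<close>)
    ultimately have "reads (nbrs (As @ diamond # ?R)) p (p+1) (2 # w)"
      by (intro reads.diamond[where z = "p+4" and x' = "p+5"]) (simp_all add: numeral_eq_Suc)
    then show ?thesis unfolding eq using True by simp
  next
    case False
    then have b: "b = 3" using Cons.prems(1) by auto
    then have eq: "As @ map block_of (b # w) @ [right_cap] = As @ k33_minus_edge # ?R" by (simp add: block_of_def)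
    note N = nbrs_k33[OF Cons.prems(2) R]
    have T: "nbrs (As @ k33_minus_edge # ?R) (p+1) - {p} = {p+2,p+3}" unfolding N by auto
    have "k33_at (nbrs (As @ k33_minus_edge # ?R)) p (p+1) (p+6) (p+7)"
      unfolding k33_at_def Let_def T
      by (intro conjI exI[of _ "{p+4,p+5}"]) (simp_all add: N insert_commute del: add_2_eq_Suc')
    moreover have "reads (nbrs ((As @ [k33_minus_edge]) @ ?R)) (p+6) (p+6+1) w"
      by (rule Cons.IH) (use Cons.prems in \<open>auto simp: k33_minus_edge_def\<close>)
    ultimately have "reads (nbrs (As @ k33_minus_edge # ?R)) p (p+1) (3 # w)"
      by (intro reads.k33[where z = "p+6" and x' = "p+7"]) (simp_all add: numeral_eq_Suc)
    then show ?thesis unfolding eq using b by simp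
  qed
qed

lemma left_cap_at:
  assumes "0 < total_size Cs"
  shows "cap_at (nbrs (left_cap # Cs)) 5 4"
proof -
  note N = nbrs_left_cap[OF assms]
  have T: "nbrs (left_cap # Cs) 4 - {5} = {2,3}" unfolding N by auto
  show ?thesis
    unfolding cap_at_def Let_def T
    by (intro conjI exI[of _ "{0,1}"]) (simp_all add: N insert_commute del: add_2_eq_Suc')
qed

section \<open>Caps occur only at the two ends of a chain\<close>

text \<open>Necessary conditions that can be refuted from a neighbourhood table: the two neighbours
  of \<open>y\<close> other than \<open>x\<close> both have neighbourhood C together with
  \<open>y\<close>, and C contains an edge.\<close>

lemma cap_at_cases:
  assumes "cap_at N x y" "N y = {a, b, c}" "x \<in> N y" "a \<noteq> b" "a \<noteq> c" "b \<noteq> c"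
  obtains "x = a" "N b = N c" "\<exists>e\<in>N b - {y}. N e \<inter> (N b - {y}) \<noteq> {}"
  | "x = b" "N a = N c" "\<exists>e\<in>N a - {y}. N e \<inter> (N a - {y}) \<noteq> {}"
  | "x = c" "N a = N b" "\<exists>e\<in>N a - {y}. N e \<inter> (N a - {y}) \<noteq> {}"
proof -
  from cap_atD(3)[OF assms(1)] obtain C where
    C: "y \<notin> C" "\<forall>a\<in>N y - {x}. N a = insert y C" "\<exists>c\<in>C. N c \<inter> C \<noteq> {}"
    by (elim exE conjE) (rule that)
  have *: "N u = N v \<and> (\<exists>e\<in>N u - {y}. N e \<inter> (N u - {y}) \<noteq> {})" if "u \<in> N y - {x}" "v \<in> N y - {x}" for u v
  proof -
    have uv: "N u = insert y C" "N v = insert y C" by (rule bspec[OF C(2)], rule that)+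
    have "insert y C - {y} = C" using C(1) by simp
    then show ?thesis using C(3) unfolding uv by simp
  qed
  have "x = a \<or> x = b \<or> x = c" using assms(2,3) by simp
  then show thesis
  proof (elim disjE)
    assume "x = a"
    moreover have "b \<in> N y - {x}" "c \<in> N y - {x}" unfolding assms(2) using calculation assms(4-) by auto
    ultimately show thesis using *[of b c] that(1) by blast
  next
    assume "x = b"
    moreover have "a \<in> N y - {x}" "c \<in> N y - {x}" unfolding assms(2) using calculation assms(4-) by auto
    ultimately show thesis using *[of a c] that(2) by blast
  next
    assume "x = c"
    moreover have "a \<in> N y - {x}" "b \<in> N y - {x}" unfolding assms(2) using calculation assms(4-) by auto
    ultimately show thesis using *[of a b] that(3) by blast
  qed
qed

text \<open>For each choice of \<open>x\<close> the two remaining neighbours have different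
  neighbourhoods, and the facts F exhibit a vertex separating them. \<open>low\<close> and
  \<open>high\<close> serve when one of the two lies beyond a bridge, where the table says
  nothing.\<close>

lemma not_cap_at_diamond:
  fixes N :: "nat \<Rightarrow> nat set"
  assumes N: "N (p + 1) = {p, p + 2, p + 3}"
      "N (p + 2) = {p + 1, p + 3, p + 4}"
      "N (p + 3) = {p + 1, p + 2, p + 4}"
      "N (p + 4) = {p + 2, p + 3, p + 5}"
    and low: "p + 4 \<notin> N p"
    and high: "p + 1 \<notin> N (p + 5)"
    and cap: "cap_at N x y" and x: "x \<in> N y" and y: "y \<in> {p + 1, p + 2, p + 3, p + 4}"
  shows "False"
proof -
  from y consider "y = p + 1" | "y = p + 2" | "y = p + 3" | "y = p + 4" by blast
  then show ?thesis
  proof cases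
    case 1
    have F: "p + 2 \<notin> N (p + 2)"
      "p + 2 \<in> N (p + 3)"
      "p + 4 \<in> N (p + 2)"
      "p + 4 \<in> N (p + 3)"
      by (simp_all add: N insert_Diff_if del: add_2_eq_Suc' One_nat_def)
    show ?thesis
      by (rule cap_at_cases[OF cap[unfolded 1] N(1) x[unfolded 1]])
        ((simp add: 1; fail) | (metis F low high))+
  next
    case 2
    have F: "p \<in> N (p + 1)"
      "p \<notin> N (p + 3)"
      "p \<notin> N (p + 4)"
      "p + 1 \<in> N (p + 3)"
      "p + 1 \<notin> N (p + 4)"
      by (simp_all add: N insert_Diff_if del: add_2_eq_Suc' One_nat_def)
    show ?thesis
      by (rule cap_at_cases[OF cap[unfolded 2] N(2) x[unfolded 2]])
        ((simp add: 2; fail) | (metis F low high))+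
  next
    case 3
    have F: "p \<in> N (p + 1)"
      "p \<notin> N (p + 2)"
      "p \<notin> N (p + 4)"
      "p + 1 \<in> N (p + 2)"
      "p + 1 \<notin> N (p + 4)"
      by (simp_all add: N insert_Diff_if del: add_2_eq_Suc' One_nat_def)
    show ?thesis
      by (rule cap_at_cases[OF cap[unfolded 3] N(3) x[unfolded 3]])
        ((simp add: 3; fail) | (metis F low high))+
  next
    case 4
    have F: "p + 1 \<in> N (p + 2)"
      "p + 1 \<in> N (p + 3)"
      "p + 2 \<notin> N (p + 2)"
      "p + 2 \<in> N (p + 3)"
      by (simp_all add: N insert_Diff_if del: add_2_eq_Suc' One_nat_def)
    show ?thesis
      by (rule cap_at_cases[OF cap[unfolded 4] N(4) x[unfolded 4]])
        ((simp add: 4; fail) | (metis F low high))+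
  qed
qed

text \<open>Here p+2, p+3 and likewise p+4, p+5 are twins with equal neighbourhoods; for these the
  obstruction is that the candidate for C contains no edge.\<close>

lemma not_cap_at_k33:
  fixes N :: "nat \<Rightarrow> nat set"
  assumes N: "N (p + 1) = {p, p + 2, p + 3}"
      "N (p + 2) = {p + 1, p + 4, p + 5}"
      "N (p + 3) = {p + 1, p + 4, p + 5}"
      "N (p + 4) = {p + 2, p + 3, p + 6}"
      "N (p + 5) = {p + 2, p + 3, p + 6}"
      "N (p + 6) = {p + 4, p + 5, p + 7}"
    and low: "p + 4 \<notin> N p"
    and high: "p + 2 \<notin> N (p + 7)"
    and cap: "cap_at N x y" and x: "x \<in> N y" and y: "y \<in> {p + 1, p + 2, p + 3, p + 4, p + 5, p + 6}"
  shows "False"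
proof -
  from y consider "y = p + 1" | "y = p + 2" | "y = p + 3" | "y = p + 4" | "y = p + 5" | "y = p + 6" by blast
  then show ?thesis
  proof cases
    case 1
    have F: "p + 4 \<in> N (p + 2)"
      "p + 4 \<in> N (p + 3)"
      "\<not> (\<exists>e\<in>N (p + 2) - {p + 1}. N e \<inter> (N (p + 2) - {p + 1}) \<noteq> {})"
      by (simp_all add: N insert_Diff_if del: add_2_eq_Suc' One_nat_def)
    show ?thesis
      by (rule cap_at_cases[OF cap[unfolded 1] N(1) x[unfolded 1]])
        ((simp add: 1; fail) | (metis F low high))+
  next
    case 2
    have F: "p \<in> N (p + 1)"
      "p \<notin> N (p + 4)"
      "p \<notin> N (p + 5)"
      "\<not> (\<exists>e\<in>N (p + 4) - {p + 2}. N e \<inter> (N (p + 4) - {p + 2}) \<noteq> {})"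
      by (simp_all add: N insert_Diff_if del: add_2_eq_Suc' One_nat_def)
    show ?thesis
      by (rule cap_at_cases[OF cap[unfolded 2] N(2) x[unfolded 2]])
        ((simp add: 2; fail) | (metis F low high))+
  next
    case 3
    have F: "p \<in> N (p + 1)"
      "p \<notin> N (p + 4)"
      "p \<notin> N (p + 5)"
      "\<not> (\<exists>e\<in>N (p + 4) - {p + 3}. N e \<inter> (N (p + 4) - {p + 3}) \<noteq> {})"
      by (simp_all add: N insert_Diff_if del: add_2_eq_Suc' One_nat_def)
    show ?thesis
      by (rule cap_at_cases[OF cap[unfolded 3] N(3) x[unfolded 3]])
        ((simp add: 3; fail) | (metis F low high))+
  next
    case 4
    have F: "p + 1 \<in> N (p + 2)"
      "p + 1 \<in> N (p + 3)"
      "p + 1 \<notin> N (p + 6)"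
      "\<not> (\<exists>e\<in>N (p + 2) - {p + 4}. N e \<inter> (N (p + 2) - {p + 4}) \<noteq> {})"
      by (simp_all add: N insert_Diff_if del: add_2_eq_Suc' One_nat_def)
    show ?thesis
      by (rule cap_at_cases[OF cap[unfolded 4] N(4) x[unfolded 4]])
        ((simp add: 4; fail) | (metis F low high))+
  next
    case 5
    have F: "p + 1 \<in> N (p + 2)"
      "p + 1 \<in> N (p + 3)"
      "p + 1 \<notin> N (p + 6)"
      "\<not> (\<exists>e\<in>N (p + 2) - {p + 5}. N e \<inter> (N (p + 2) - {p + 5}) \<noteq> {})"
      by (simp_all add: N insert_Diff_if del: add_2_eq_Suc' One_nat_def)
    show ?thesis
      by (rule cap_at_cases[OF cap[unfolded 5] N(5) x[unfolded 5]])
        ((simp add: 5; fail) | (metis F low high))+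
  next
    case 6
    have F: "p + 2 \<in> N (p + 4)"
      "p + 2 \<in> N (p + 5)"
      "\<not> (\<exists>e\<in>N (p + 4) - {p + 6}. N e \<inter> (N (p + 4) - {p + 6}) \<noteq> {})"
      by (simp_all add: N insert_Diff_if del: add_2_eq_Suc' One_nat_def)
    show ?thesis
      by (rule cap_at_cases[OF cap[unfolded 6] N(6) x[unfolded 6]])
        ((simp add: 6; fail) | (metis F low high))+
  qed
qed

lemma cap_at_left_cap:
  fixes N :: "nat \<Rightarrow> nat set"
  assumes N: "N 0 = {1, 2, 3}"
      "N 1 = {0, 2, 3}"
      "N 2 = {0, 1, 4}"
      "N 3 = {0, 1, 4}"
      "N 4 = {2, 3, 5}"
    and high: "0 \<notin> N 5"
    and cap: "cap_at N x y" and x: "x \<in> N y" and y: "y \<in> {0, 1, 2, 3, 4}"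
  shows "x = 5 \<and> y = 4"
proof -
  from y consider "y = 0" | "y = 1" | "y = 2" | "y = 3" | "y = 4" by blast
  then show ?thesis
  proof cases
    case 1
    have F: "1 \<notin> N 1"
      "1 \<in> N 2"
      "1 \<in> N 3"
      \<comment> \<open>The twins 2 and 3 cannot be separated; with \<open>x = 1\<close> the
        candidate for C is 1 and 4, which are not adjacent.\<close>
      "\<not> (\<exists>e\<in>N 2 - {0}. N e \<inter> (N 2 - {0}) \<noteq> {})"
      by (simp_all add: N insert_Diff_if del: add_2_eq_Suc' One_nat_def)
    show ?thesis
      by (rule cap_at_cases[OF cap[unfolded 1] N(1) x[unfolded 1]])
        ((simp add: 1; fail) | (metis F high))+
  next
    case 2
    have F: "0 \<notin> N 0"
      "0 \<in> N 2"
      "0 \<in> N 3"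
      "\<not> (\<exists>e\<in>N 2 - {1}. N e \<inter> (N 2 - {1}) \<noteq> {})"
      by (simp_all add: N insert_Diff_if del: add_2_eq_Suc' One_nat_def)
    show ?thesis
      by (rule cap_at_cases[OF cap[unfolded 2] N(2) x[unfolded 2]])
        ((simp add: 2; fail) | (metis F high))+
  next
    case 3
    have F: "0 \<notin> N 0"
      "0 \<in> N 1"
      "0 \<notin> N 4"
      "1 \<in> N 0"
      "1 \<notin> N 4"
      by (simp_all add: N insert_Diff_if del: add_2_eq_Suc' One_nat_def)
    show ?thesis
      by (rule cap_at_cases[OF cap[unfolded 3] N(3) x[unfolded 3]])
        ((simp add: 3; fail) | (metis F high))+
  next
    case 4
    have F: "0 \<notin> N 0"
      "0 \<in> N 1"
      "0 \<notin> N 4"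
      "1 \<in> N 0"
      "1 \<notin> N 4"
      by (simp_all add: N insert_Diff_if del: add_2_eq_Suc' One_nat_def)
    show ?thesis
      by (rule cap_at_cases[OF cap[unfolded 4] N(4) x[unfolded 4]])
        ((simp add: 4; fail) | (metis F high))+
  next
    case 5
    have F: "0 \<in> N 2"
      "0 \<in> N 3"
      by (simp_all add: N insert_Diff_if del: add_2_eq_Suc' One_nat_def)
    show ?thesis
      by (rule cap_at_cases[OF cap[unfolded 5] N(5) x[unfolded 5]])
        ((simp add: 5; fail) | (metis F high))+
  qed
qed

lemma cap_at_right_cap:
  fixes N :: "nat \<Rightarrow> nat set"
  assumes N: "N (p + 1) = {p, p + 2, p + 3}"
      "N (p + 2) = {p + 1, p + 4, p + 5}"
      "N (p + 3) = {p + 1, p + 4, p + 5}"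
      "N (p + 4) = {p + 2, p + 3, p + 5}"
      "N (p + 5) = {p + 2, p + 3, p + 4}"
    and low: "p + 4 \<notin> N p"
    and cap: "cap_at N x y" and x: "x \<in> N y" and y: "y \<in> {p + 1, p + 2, p + 3, p + 4, p + 5}"
  shows "x = p \<and> y = p + 1"
proof -
  from y consider "y = p + 1" | "y = p + 2" | "y = p + 3" | "y = p + 4" | "y = p + 5" by blast
  then show ?thesis
  proof cases
    case 1
    have F: "p + 4 \<in> N (p + 2)"
      "p + 4 \<in> N (p + 3)"
      by (simp_all add: N insert_Diff_if del: add_2_eq_Suc' One_nat_def)
    show ?thesis
      by (rule cap_at_cases[OF cap[unfolded 1] N(1) x[unfolded 1]])
        ((simp add: 1; fail) | (metis F low))+
  next
    case 2
    have F: "p \<in> N (p + 1)"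
      "p \<notin> N (p + 4)"
      "p \<notin> N (p + 5)"
      "p + 4 \<notin> N (p + 4)"
      "p + 4 \<in> N (p + 5)"
      by (simp_all add: N insert_Diff_if del: add_2_eq_Suc' One_nat_def)
    show ?thesis
      by (rule cap_at_cases[OF cap[unfolded 2] N(2) x[unfolded 2]])
        ((simp add: 2; fail) | (metis F low))+
  next
    case 3
    have F: "p \<in> N (p + 1)"
      "p \<notin> N (p + 4)"
      "p \<notin> N (p + 5)"
      "p + 4 \<notin> N (p + 4)"
      "p + 4 \<in> N (p + 5)"
      by (simp_all add: N insert_Diff_if del: add_2_eq_Suc' One_nat_def)
    show ?thesis
      by (rule cap_at_cases[OF cap[unfolded 3] N(3) x[unfolded 3]])
        ((simp add: 3; fail) | (metis F low))+
  next
    case 4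
    have F: "p + 1 \<in> N (p + 2)"
      "p + 1 \<in> N (p + 3)"
      "p + 1 \<notin> N (p + 5)"
      "\<not> (\<exists>e\<in>N (p + 2) - {p + 4}. N e \<inter> (N (p + 2) - {p + 4}) \<noteq> {})"
      by (simp_all add: N insert_Diff_if del: add_2_eq_Suc' One_nat_def)
    show ?thesis
      by (rule cap_at_cases[OF cap[unfolded 4] N(4) x[unfolded 4]])
        ((simp add: 4; fail) | (metis F low))+
  next
    case 5
    have F: "p + 1 \<in> N (p + 2)"
      "p + 1 \<in> N (p + 3)"
      "p + 1 \<notin> N (p + 4)"
      "\<not> (\<exists>e\<in>N (p + 2) - {p + 5}. N e \<inter> (N (p + 2) - {p + 5}) \<noteq> {})"
      by (simp_all add: N insert_Diff_if del: add_2_eq_Suc' One_nat_def)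
    show ?thesis
      by (rule cap_at_cases[OF cap[unfolded 5] N(5) x[unfolded 5]])
        ((simp add: 5; fail) | (metis F low))+
  qed
qed

lemma nbrs_far:
  assumes "i < total_size As" "total_size As \<le> j" "Suc i \<noteq> total_size As \<or> j \<noteq> total_size As"
  shows "i \<notin> nbrs (As @ Cs) j" "j \<notin> nbrs (As @ Cs) i"
  using assms by (auto simp: nbrs_def chain_adj_append Let_def)

lemma block_containing:
  assumes "y < total_size Bs"
  shows "\<exists>As B Cs. Bs = As @ B # Cs \<and> total_size As \<le> y \<and> y < total_size As + fst B"
  using assms
proof (induction Bs arbitrary: y)
  case (Cons A Bs)
  show ?case
  proof (cases "y < fst A")
    case True
    then have "A # Bs = [] @ A # Bs \<and> total_size [] \<le> y \<and> y < total_size [] + fst A" by simp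
    then show ?thesis by blast
  next
    case False
    then have "y - fst A < total_size Bs" using Cons.prems by simp
    from Cons.IH[OF this] obtain As B Cs where
      "Bs = As @ B # Cs" "total_size As \<le> y - fst A" "y - fst A < total_size As + fst B"
      by blast
    then have "A # Bs = (A # As) @ B # Cs \<and> total_size (A # As) \<le> y \<and> y < total_size (A # As) + fst B"
      using False by auto
    then show ?thesis by blast
  qed
qed simp

lemma chain_vertex_cases:
  assumes w: "set w \<subseteq> {2,3}" and "y < total_size (chain_blocks w)"
  obtains (left) Cs where "chain_blocks w = left_cap # Cs" "0 < total_size Cs" "y \<in> {0,1,2,3,4}"
  | (right) As p where "chain_blocks w = As @ [right_cap]" "total_size As = Suc p"
      "y \<in> {p+1,p+2,p+3,p+4,p+5}"
  | (diamond) As Cs p where "chain_blocks w = As @ diamond # Cs" "total_size As = Suc p"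
      "0 < total_size Cs" "y \<in> {p+1,p+2,p+3,p+4}"
  | (k33) As Cs p where "chain_blocks w = As @ k33_minus_edge # Cs" "total_size As = Suc p"
      "0 < total_size Cs" "y \<in> {p+1,p+2,p+3,p+4,p+5,p+6}"
proof -
  obtain As B Cs where split: "chain_blocks w = As @ B # Cs"
    and y: "total_size As \<le> y" "y < total_size As + fst B"
    using block_containing[OF assms(2)] by blast
  show thesis
  proof (cases As)
    case Nil
    have B: "B = left_cap" "Cs = map block_of w @ [right_cap]"
      using split Nil by (simp_all add: chain_blocks_def)
    have "y < 5" using y B Nil by (simp add: left_cap_def)
    then have "y \<in> {0,1,2,3,4}" by auto
    then show thesis using left[of Cs] split Nil B by (simp add: right_cap_def)
  next
    case (Cons A As')
    then have "A = left_cap" using split by (simp add: chain_blocks_def)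
    then have "0 < total_size As" using Cons by (simp add: left_cap_def)
    then obtain p where p: "total_size As = Suc p" by (cases "total_size As") auto
    have rest: "As' @ B # Cs = map block_of w @ [right_cap]"
      using split Cons by (simp add: chain_blocks_def)
    show thesis
    proof (cases Cs rule: rev_cases)
      case Nil
      then have B: "B = right_cap" using rest by simp
      have "y < p + 6" "p < y" using y B p by (simp_all add: right_cap_def)
      then have "y \<in> {p+1,p+2,p+3,p+4,p+5}" by auto
      then show thesis using right[of As p] split p Nil B by simp
    next
      case (snoc Cs' C)
      then have "As' @ B # Cs' = map block_of w" "C = right_cap" using rest by simp_all
      then have "B \<in> block_of ` set w" and Cs: "0 < total_size Cs"
        using snoc by (auto simp: right_cap_def) (metis in_set_conv_decomp set_map)
      then obtain b where b: "B = block_of b" "b = 2 \<or> b = 3" using w by auto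
      show thesis
      proof (cases "b = 2")
        case True
        then have B: "B = diamond" using b by (simp add: block_of_def)
        have "y < p + 5" "p < y" using y B p by (simp_all add: diamond_def)
        then have "y \<in> {p+1,p+2,p+3,p+4}" by auto
        then show thesis using diamond split p B Cs by blast
      next
        case False
        then have B: "B = k33_minus_edge" using b by (simp add: block_of_def)
        have "y < p + 7" "p < y" using y B p by (simp_all add: k33_minus_edge_def)
        then have "y \<in> {p+1,p+2,p+3,p+4,p+5,p+6}" by auto
        then show thesis using k33 split p B Cs by blast
      qed
    qed
  qed
qed

text \<open>Makes the pair of ends recognisable from the graph: the two directed edges are the
  outermost bridges, each traversed towards its cap of 5 vertices.\<close>

lemma cap_at_chain:
  assumes w: "set w \<subseteq> {2,3}" and cap: "cap_at (nbrs (chain_blocks w)) x y"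
    and x: "x \<in> nbrs (chain_blocks w) y"
  shows "x = 5 \<and> y = 4 \<or>
    x = total_size (chain_blocks w) - 6 \<and> y = total_size (chain_blocks w) - 5"
proof -
  have low: "p + 4 \<notin> nbrs (As @ Cs) p" if "total_size As = Suc p" for As Cs p
    using nbrs_far(2)[of p As "p + 4"] that by simp
  have high: "j \<notin> nbrs (As @ B # Cs) i"
    if "total_size As + fst B = i" "Suc j < i" for As B Cs i j
    using nbrs_far(1)[of j "As @ [B]" i Cs] that by simp
  have "y < total_size (chain_blocks w)" using x by (simp add: nbrs_def)
  with w show ?thesis
  proof (cases rule: chain_vertex_cases)
    case (left Cs)
    have "0 \<notin> nbrs (left_cap # Cs) 5"
      using high[of "[]" left_cap 5 0 Cs] by (simp add: left_cap_def)
    from cap_at_left_cap[OF nbrs_left_cap[OF left(2)] this cap[unfolded left(1)] x[unfolded left(1)] left(3)]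
    show ?thesis ..
  next
    case (right As p)
    from cap_at_right_cap[OF nbrs_right_cap[OF right(2)] low[OF right(2)] cap[unfolded right(1)]
        x[unfolded right(1)] right(3)]
    have "x = p" "y = p + 1" by simp_all
    moreover have "total_size (chain_blocks w) = p + 6"
      unfolding right(1) using right(2) by (simp add: right_cap_def)
    ultimately show ?thesis by simp
  next
    case (diamond As Cs p)
    have "p + 1 \<notin> nbrs (As @ diamond # Cs) (p + 5)"
      using diamond(2) by (intro high) (simp_all add: diamond_def)
    from not_cap_at_diamond[OF nbrs_diamond[OF diamond(2,3)] low[OF diamond(2)] this
        cap[unfolded diamond(1)] x[unfolded diamond(1)] diamond(4)]
    show ?thesis ..
  next
    case (k33 As Cs p)
    have "p + 2 \<notin> nbrs (As @ k33_minus_edge # Cs) (p + 7)"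
      using k33(2) by (intro high) (simp_all add: k33_minus_edge_def)
    from not_cap_at_k33[OF nbrs_k33[OF k33(2,3)] low[OF k33(2)] this
        cap[unfolded k33(1)] x[unfolded k33(1)] k33(4)]
    show ?thesis ..
  qed
qed

text \<open>The smaller neighbour of every vertex but 0 is what connectedness is later deduced
  from.\<close>

lemma chain_cubic:
  assumes "set w \<subseteq> {2,3}" "y < total_size (chain_blocks w)"
  shows "card (nbrs (chain_blocks w) y) = 3 \<and> (0 < y \<longrightarrow> (\<exists>x\<in>nbrs (chain_blocks w) y. x < y))"
  using assms
proof (cases rule: chain_vertex_cases)
  case (left Cs)
  then show ?thesis using nbrs_left_cap[OF left(2)] by auto
next
  case (right As p)
  note N = nbrs_right_cap[OF right(2)]
  from right(3) show ?thesis unfolding right(1) by (elim insertE emptyE) (simp_all only: N, auto)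
next
  case (diamond As Cs p)
  note N = nbrs_diamond[OF diamond(2,3)]
  from diamond(4) show ?thesis unfolding diamond(1) by (elim insertE emptyE) (simp_all only: N, auto)
next
  case (k33 As Cs p)
  note N = nbrs_k33[OF k33(2,3)]
  from k33(4) show ?thesis unfolding k33(1) by (elim insertE emptyE) (simp_all only: N, auto)
qed

lemma reads_chain_blocks:
  assumes "set w \<subseteq> {2,3}"
  shows "reads (nbrs (chain_blocks w)) 4 5 w"
  using reads_chain[OF assms, of "[left_cap]" 4] by (simp add: chain_blocks_def left_cap_def)

text \<open>The reversal of the vertex numbers is continued by the identity beyond the chain, which
  gives the total injection required by \<open>reads_iso\<close>.\<close>

lemma nbrs_rev:
  fixes w
  defines "t \<equiv> total_size (chain_blocks w)"
  defines "g \<equiv> \<lambda>i. if i < t then t - 1 - i else i"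
  shows "inj g" "nbrs (chain_blocks (rev w)) (g i) = g ` nbrs (chain_blocks w) i"
proof -
  have gg: "g (g i) = i" for i by (auto simp: g_def)
  then show "inj g" by (metis injI)
  have adj: "chain_adj (chain_blocks (rev w)) (g i) (g j) \<longleftrightarrow> chain_adj (chain_blocks w) i j"
    if "i < t" "j < t" for i j
    using chain_adj_rev[of i w j] that by (simp add: g_def t_def)
  have lt: "g i < t \<longleftrightarrow> i < t" for i by (auto simp: g_def)
  show "nbrs (chain_blocks (rev w)) (g i) = g ` nbrs (chain_blocks w) i"
  proof (rule set_eqI)
    fix v
    have "v \<in> nbrs (chain_blocks (rev w)) (g i) \<longleftrightarrow> g v \<in> nbrs (chain_blocks w) i"
      using adj[of i "g v"] lt by (auto simp: nbrs_def gg t_def[symmetric])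
    also have "\<dots> \<longleftrightarrow> v \<in> g ` nbrs (chain_blocks w) i"
      using gg by (metis image_iff)
    finally show "v \<in> nbrs (chain_blocks (rev w)) (g i) \<longleftrightarrow> v \<in> g ` nbrs (chain_blocks w) i" .
  qed
qed

text \<open>The edge entering the left cap must go to an edge entering a cap of the other chain. If
  it is the left one, both words are read from corresponding starts; if it is the right one, the
  other chain is first reversed.\<close>

lemma chain_iso_imp_eq_or_rev:
  assumes w: "set w \<subseteq> {2,3}" and v: "set v \<subseteq> {2,3}" and f: "inj f"
    and N: "\<And>i. nbrs (chain_blocks v) (f i) = f ` nbrs (chain_blocks w) i"
  shows "w = v \<or> w = rev v"
proof -
  let ?C = "map block_of w @ [right_cap]"
  have chain: "chain_blocks w = left_cap # ?C" by (simp add: chain_blocks_def)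
  have pos: "0 < total_size ?C" by (simp add: right_cap_def)
  \<comment> \<open>A cap is the reading of the empty word, so \<open>reads_iso\<close> transports
    it without a separate lemma.\<close>
  have "reads (nbrs (chain_blocks w)) 5 4 []"
    unfolding chain by (rule reads.cap) (rule left_cap_at[OF pos])
  from reads_iso[OF f N this] have "cap_at (nbrs (chain_blocks v)) (f 5) (f 4)"
    by cases
  moreover have "f 5 \<in> nbrs (chain_blocks v) (f 4)"
    using nbrs_left_cap(5)[OF pos] unfolding N chain by (intro imageI) simp
  ultimately have "f 5 = 5 \<and> f 4 = 4 \<or> f 5 = total_size (chain_blocks v) - 6 \<and> f 4 = total_size (chain_blocks v) - 5"
    by (rule cap_at_chain[OF v])
  then show ?thesis
  proof
    assume f: "f 5 = 5 \<and> f 4 = 4"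
    have "reads (nbrs (chain_blocks v)) 4 5 w"
      using reads_iso[OF \<open>inj f\<close> N reads_chain_blocks[OF w]] f by simp
    then show ?thesis using reads_deterministic[OF _ reads_chain_blocks[OF v]] by blast
  next
    let ?t = "total_size (chain_blocks v)"
    assume f: "f 5 = ?t - 6 \<and> f 4 = ?t - 5"
    have t: "10 \<le> ?t" using chain_size[OF v] by simp
    have r: "reads (nbrs (chain_blocks v)) (?t - 5) (?t - 6) w"
      using reads_iso[OF \<open>inj f\<close> N reads_chain_blocks[OF w]] f by simp
    \<comment> \<open>The reversal i to t - 1 - i sends t - 5 and t - 6 to 4 and 5.\<close>
    have 1: "reads (nbrs (chain_blocks (rev v))) 4 5 w"
      using reads_iso[OF nbrs_rev r] t by simp
    have 2: "reads (nbrs (chain_blocks (rev v))) 4 5 (rev v)"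
      by (rule reads_chain_blocks) (use v in simp)
    show ?thesis using reads_deterministic[OF 1 2] by simp
  qed
qed

section \<open>Graphs of diagrams\<close>

text \<open>A \<open>digraph_iso\<close> also carries a map on arcs and new tail and head functions.
  For graphs of the form \<open>with_proj G\<close> all of these are determined by the vertex map
  kept here.\<close>

definition pair_iso :: "('a \<Rightarrow> 'b) \<Rightarrow> 'a pair_pre_digraph \<Rightarrow> 'b pair_pre_digraph \<Rightarrow> bool" where
  "pair_iso f G H \<longleftrightarrow> bij_betw f (pverts G) (pverts H) \<and>
     (\<forall>u\<in>pverts G. \<forall>v\<in>pverts G. (f u, f v) \<in> parcs H \<longleftrightarrow> (u, v) \<in> parcs G)"

lemma pair_isoI_digraph_iso:
  assumes "pair_wf_digraph G" "pair_wf_digraph H" "pair_iso f G H"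
  shows "digraph_iso (with_proj G) (with_proj H)"
proof -
  interpret G: pair_wf_digraph G by fact
  interpret H: pair_wf_digraph H by fact
  define hom where "hom = \<lparr>iso_verts = f, iso_arcs = map_prod f f, iso_head = snd, iso_tail = fst\<rparr>"
  have bij: "bij_betw f (pverts G) (pverts H)" using assms(3) by (simp add: pair_iso_def)
  have adj: "(f u, f v) \<in> parcs H \<longleftrightarrow> (u, v) \<in> parcs G" if "u \<in> pverts G" "v \<in> pverts G" for u v
    using assms(3) that by (simp add: pair_iso_def)
  have "pre_digraph.digraph_isomorphism (with_proj G) hom"
    unfolding pre_digraph.digraph_isomorphism_def
  proof (intro conjI ballI)
    show "wf_digraph (with_proj G)" by (rule G.wf_digraph_axioms)
    show "inj_on (iso_verts hom) (verts (with_proj G))" using bij by (simp add: hom_def bij_betw_def)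
    show "inj_on (iso_arcs hom) (arcs (with_proj G))"
      using bij G.in_arcsD1 G.in_arcsD2
      by (auto simp: hom_def bij_betw_def inj_on_def)
  qed (simp_all add: hom_def)
  moreover have "map_prod f f ` parcs G = parcs H"
  proof (intro equalityI subsetI)
    fix e assume "e \<in> map_prod f f ` parcs G"
    then show "e \<in> parcs H" using adj G.in_arcsD1 G.in_arcsD2 by auto
  next
    fix e assume e: "e \<in> parcs H"
    obtain a b where ab: "e = (a, b)" by fastforce
    then have "a \<in> f ` pverts G" "b \<in> f ` pverts G"
      using e H.in_arcsD1 H.in_arcsD2 bij by (auto simp: bij_betw_def)
    then obtain u v where "u \<in> pverts G" "v \<in> pverts G" "a = f u" "b = f v" by blast
    then have "(u, v) \<in> parcs G" "e = map_prod f f (u, v)" using e ab adj by auto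
    then show "e \<in> map_prod f f ` parcs G" by blast
  qed
  then have "with_proj H = app_iso hom (with_proj G)"
    using bij by (simp add: app_iso_def hom_def with_proj_def bij_betw_def)
  ultimately show ?thesis unfolding digraph_iso_def by blast
qed

lemma digraph_isoE_pair_iso:
  assumes "pair_wf_digraph G" "digraph_iso (with_proj G) (with_proj H)"
  obtains f where "pair_iso f G H"
proof -
  interpret G: pair_wf_digraph G by fact
  obtain hom where hom: "pre_digraph.digraph_isomorphism (with_proj G) hom"
    and H: "with_proj H = app_iso hom (with_proj G)"
    using assms(2) by (auto simp: digraph_iso_def)
  define f where "f = iso_verts hom"
  have inj: "inj_on f (pverts G)"
    using hom by (simp add: pre_digraph.digraph_isomorphism_def f_def)
  have V: "pverts H = f ` pverts G"
    using arg_cong[OF H, of verts] by (simp add: f_def)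
  \<comment> \<open>The tail and head functions of the image are those stored in \<open>hom\<close>,
    so they are the projections; this forces the map on arcs.\<close>
  have tl: "iso_tail hom = fst" and hd: "iso_head hom = snd"
    using arg_cong[OF H, of tail] arg_cong[OF H, of head] by simp_all
  have arc: "iso_arcs hom e = map_prod f f e" if "e \<in> parcs G" for e
    using hom that by (auto simp: pre_digraph.digraph_isomorphism_def f_def tl hd prod_eq_iff)
  have E: "parcs H = map_prod f f ` parcs G"
    using arg_cong[OF H, of arcs] arc by (simp cong: image_cong)
  have "(f u, f v) \<in> parcs H \<longleftrightarrow> (u, v) \<in> parcs G" if "u \<in> pverts G" "v \<in> pverts G" for u v
  proof
    assume "(f u, f v) \<in> parcs H"
    then obtain a b where ab: "(a, b) \<in> parcs G" "f a = f u" "f b = f v" unfolding E by auto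
    then have "a = u" "b = v"
      using inj that G.in_arcsD1[OF ab(1)] G.in_arcsD2[OF ab(1)] by (auto dest: inj_onD)
    then show "(u, v) \<in> parcs G" using ab by simp
  next
    assume "(u, v) \<in> parcs G"
    then show "(f u, f v) \<in> parcs H" unfolding E by force
  qed
  then have "pair_iso f G H" using inj V by (simp add: pair_iso_def bij_betw_def)
  then show thesis by (rule that)
qed

lemma pair_iso_id: "pair_iso (\<lambda>x. x) G G"
  by (simp add: pair_iso_def bij_betw_def)

lemma pair_iso_comp: "pair_iso f G H \<Longrightarrow> pair_iso g H K \<Longrightarrow> pair_iso (g \<circ> f) G K"
  unfolding pair_iso_def by (auto intro: bij_betw_trans dest: bij_betwE)

lemma pair_iso_inv:
  assumes "pair_iso f G H"
  shows "pair_iso (inv_into (pverts G) f) H G"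
proof -
  have bij: "bij_betw f (pverts G) (pverts H)" using assms by (simp add: pair_iso_def)
  let ?g = "inv_into (pverts G) f"
  have g: "bij_betw ?g (pverts H) (pverts G)" by (rule bij_betw_inv_into[OF bij])
  have "(?g u, ?g v) \<in> parcs G \<longleftrightarrow> (u, v) \<in> parcs H" if "u \<in> pverts H" "v \<in> pverts H" for u v
  proof -
    have "?g u \<in> pverts G" "?g v \<in> pverts G" using bij_betwE[OF g] that by auto
    then have "(f (?g u), f (?g v)) \<in> parcs H \<longleftrightarrow> (?g u, ?g v) \<in> parcs G"
      using assms by (simp add: pair_iso_def)
    then show ?thesis using bij_betw_inv_into_right[OF bij] that by simp
  qed
  then show ?thesis using g by (simp add: pair_iso_def)
qed

abbreviation cubic_graphs :: "nat \<Rightarrow> nat pair_pre_digraph set" where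
  "cubic_graphs \<equiv> connected_cubic_permutation_graphs"

definition iso_on :: "nat \<Rightarrow> (nat pair_pre_digraph \<times> nat pair_pre_digraph) set" where
  "iso_on n = graph_iso_rel \<inter> cubic_graphs n \<times> cubic_graphs n"

lemma cubic_graphs_wf: "G \<in> cubic_graphs n \<Longrightarrow> pair_wf_digraph G"
  by (simp add: connected_cubic_permutation_graphs_def pair_graph_def pair_digraph_def pair_fin_digraph_def)

lemma iso_on_iff:
  "(G, H) \<in> iso_on n \<longleftrightarrow> G \<in> cubic_graphs n \<and> H \<in> cubic_graphs n \<and> (\<exists>f. pair_iso f G H)"
  using pair_isoI_digraph_iso[OF cubic_graphs_wf cubic_graphs_wf]
  by (auto simp: iso_on_def graph_iso_rel_def elim: digraph_isoE_pair_iso[OF cubic_graphs_wf])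

lemma equiv_iso_on: "equiv (cubic_graphs n) (iso_on n)"
proof (rule equivI)
  show "refl_on (cubic_graphs n) (iso_on n)"
    using pair_iso_id by (auto simp: refl_on_def iso_on_iff)
  show "sym (iso_on n)"
    using pair_iso_inv by (auto simp: sym_def iso_on_iff)
  show "trans (iso_on n)"
    using pair_iso_comp by (auto simp: trans_def iso_on_iff) blast
qed (auto simp: iso_on_def)

lemma card_image_cong_kernel:
  assumes "\<And>x y. x \<in> A \<Longrightarrow> y \<in> A \<Longrightarrow> f x = f y \<longleftrightarrow> g x = g y"
  shows "card (f ` A) = card (g ` A)"
proof (rule bij_betw_same_card)
  show "bij_betw (g \<circ> inv_into A f) (f ` A) (g ` A)"
    unfolding bij_betw_def
  proof
    have inv: "inv_into A f z \<in> A" "f (inv_into A f z) = z" if "z \<in> f ` A" for z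
      using that by (auto intro: inv_into_into f_inv_into_f)
    show "inj_on (g \<circ> inv_into A f) (f ` A)"
    proof (rule inj_onI)
      fix y z assume yz: "y \<in> f ` A" "z \<in> f ` A" "(g \<circ> inv_into A f) y = (g \<circ> inv_into A f) z"
      then have "f (inv_into A f y) = f (inv_into A f z)"
        using assms[OF inv(1)[OF yz(1)] inv(1)[OF yz(2)]] by simp
      then show "y = z" using inv(2) yz by simp
    qed
    show "(g \<circ> inv_into A f) ` f ` A = g ` A"
    proof (intro equalityI subsetI)
      fix z assume "z \<in> g ` A"
      then obtain x where x: "x \<in> A" "z = g x" by blast
      have "g (inv_into A f (f x)) = g x"
        using assms[OF inv(1)[of "f x"] x(1)] inv(2)[of "f x"] x(1) by simp
      then show "z \<in> (g \<circ> inv_into A f) ` f ` A" using x by force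
    qed (use inv in auto)
  qed
qed

text \<open>Here \<open>g\<close> picks representatives meeting every class, and \<open>h\<close> is
  a complete invariant of the codes, so classes correspond to values of \<open>h\<close>.\<close>

lemma card_quotient_by_codes:
  assumes R: "equiv A R" and mem: "\<And>c. c \<in> C \<Longrightarrow> g c \<in> A"
    and sur: "\<And>x. x \<in> A \<Longrightarrow> \<exists>c\<in>C. (x, g c) \<in> R"
    and ker: "\<And>c d. c \<in> C \<Longrightarrow> d \<in> C \<Longrightarrow> (g c, g d) \<in> R \<longleftrightarrow> h c = h d"
  shows "card (A // R) = card (h ` C)"
proof -
  have "A // R = (\<lambda>c. R `` {g c}) ` C"
  proof (intro equalityI subsetI)
    fix X assume "X \<in> A // R"
    then obtain x where x: "x \<in> A" "X = R `` {x}" by (rule quotientE)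
    then obtain c where "c \<in> C" "(x, g c) \<in> R" using sur by blast
    then show "X \<in> (\<lambda>c. R `` {g c}) ` C" using x equiv_class_eq[OF R] by blast
  next
    fix X assume "X \<in> (\<lambda>c. R `` {g c}) ` C"
    then show "X \<in> A // R" using mem by (auto intro: quotientI)
  qed
  moreover have "card ((\<lambda>c. R `` {g c}) ` C) = card (h ` C)"
    by (rule card_image_cong_kernel) (use ker mem eq_equiv_class_iff[OF R] in simp)
  ultimately show ?thesis by simp
qed

text \<open>A vertex is the place of a point in the list, shifted by one, and not its position in
  the diagram. This matches the numbering of \<open>chain_adj\<close> and makes the graph
  indifferent to transposition.\<close>

definition points_graph :: "(nat \<times> nat) list \<Rightarrow> nat pair_pre_digraph" where
  "points_graph ps = \<lparr>pverts = {1..length ps},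
     parcs = {(i, j). i \<in> {1..length ps} \<and> j \<in> {1..length ps} \<and> crosses (ps ! (i - 1)) (ps ! (j - 1))}\<rparr>"

lemma points_graph_simps [simp]:
  "pverts (points_graph ps) = {1..length ps}"
  "(i, j) \<in> parcs (points_graph ps) \<longleftrightarrow>
     i \<in> {1..length ps} \<and> j \<in> {1..length ps} \<and> crosses (ps ! (i - 1)) (ps ! (j - 1))"
  by (simp_all add: points_graph_def)

lemma points_graph_swap: "points_graph (map prod.swap ps) = points_graph ps"
  by (auto simp: points_graph_def)

lemma pair_graph_points_graph: "pair_graph (points_graph ps)"
proof
  show "finite (parcs (points_graph ps))"
    by (rule finite_subset[of _ "{1..length ps} \<times> {1..length ps}"]) auto
  show "symmetric (with_proj (points_graph ps))"
    using crosses_sym by (auto simp: symmetric_def sym_def)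
qed (auto simp: points_graph_def)

lemma out_degree_points_graph:
  assumes "i < length ps"
  shows "out_degree (with_proj (points_graph ps)) (Suc i) = card {j. j < length ps \<and> crosses (ps ! i) (ps ! j)}"
proof -
  have "out_arcs (with_proj (points_graph ps)) (Suc i) =
      (\<lambda>j. (Suc i, Suc j)) ` {j. j < length ps \<and> crosses (ps ! i) (ps ! j)}" (is "?L = ?R")
  proof (intro equalityI subsetI)
    fix e assume "e \<in> ?L"
    then obtain k where k: "e = (Suc i, k)" "k \<in> {1..length ps}" "crosses (ps ! i) (ps ! (k - 1))"
      by (cases e) (auto simp: out_arcs_def)
    then show "e \<in> ?R" by (intro image_eqI[of _ _ "k - 1"]) auto
  qed (use assms in \<open>auto simp: out_arcs_def\<close>)
  then show ?thesis by (simp add: out_degree_def card_image inj_on_def)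
qed

text \<open>Stepping to an earlier neighbour repeatedly leads from any vertex to vertex 1, and paths
  can be reversed.\<close>

lemma connected_points_graph:
  assumes "ps \<noteq> []" and less: "\<And>i. 0 < i \<Longrightarrow> i < length ps \<Longrightarrow> \<exists>j<i. crosses (ps ! i) (ps ! j)"
  shows "connected (with_proj (points_graph ps))"
proof -
  let ?G = "points_graph ps"
  interpret pair_graph ?G by (rule pair_graph_points_graph)
  have to_1: "Suc i \<rightarrow>\<^sup>*\<^bsub>with_proj ?G\<^esub> Suc 0" if "i < length ps" for i
    using that
  proof (induction i rule: less_induct)
    case (less i)
    show ?case
    proof (cases "i = 0")
      case True
      then show ?thesis using \<open>ps \<noteq> []\<close> by (simp add: Suc_le_eq)
    next
      case False
      then obtain j where j: "j < i" "crosses (ps ! i) (ps ! j)" using assms(2) less.prems by blast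
      then have "(Suc i, Suc j) \<in> parcs ?G" using less.prems by simp
      moreover have "Suc j \<rightarrow>\<^sup>*\<^bsub>with_proj ?G\<^esub> Suc 0" using less.IH[OF j(1)] j less.prems by simp
      ultimately show ?thesis by (rule adj_reachable_trans)
    qed
  qed
  have "u \<rightarrow>\<^sup>*\<^bsub>with_proj ?G\<^esub> v" if "u \<in> {1..length ps}" "v \<in> {1..length ps}" for u v
  proof -
    have "u \<rightarrow>\<^sup>*\<^bsub>with_proj ?G\<^esub> Suc 0" "v \<rightarrow>\<^sup>*\<^bsub>with_proj ?G\<^esub> Suc 0"
      using to_1[of "u - 1"] to_1[of "v - 1"] that by auto
    then show ?thesis using symmetric_reachable[OF pair_sym_arcs] reachable_trans by blast
  qed
  moreover have "1 \<le> length ps" using \<open>ps \<noteq> []\<close> by (cases ps) auto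
  ultimately have "strongly_connected (with_proj ?G)"
    by (simp add: strongly_connected_def)
  then show ?thesis
    unfolding connected_def strongly_connected_def
    using reachable_mk_symmetricI by simp
qed

text \<open>The labelling \<open>v\<close> sorts the vertices by the positions of their points, and
  \<pi> reads off the values in that order.\<close>

lemma permutation_graph_points_graph:
  assumes f: "fst ` set ps = {1..length ps}" and s: "snd ` set ps = {1..length ps}"
  shows "permutation_graph (points_graph ps)"
proof -
  define n where "n = length ps"
  have bij: "bij_betw (\<lambda>k. h (ps ! (k - 1))) {1..n} {1..n}" if "h ` set ps = {1..n}" for h :: "nat \<times> nat \<Rightarrow> nat"
  proof -
    have "(\<lambda>k. ps ! (k - 1)) ` {1..n} = set ps"
    proof (intro equalityI subsetI)
      fix x assume "x \<in> set ps"
      then obtain k where "k < n" "x = ps ! k" by (auto simp: in_set_conv_nth n_def)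
      then show "x \<in> (\<lambda>k. ps ! (k - 1)) ` {1..n}" by (intro image_eqI[of _ _ "Suc k"]) auto
    qed (auto simp: n_def)
    then have "(\<lambda>k. h (ps ! (k - 1))) ` {1..n} = {1..n}" using that by (metis image_image)
    then show ?thesis by (simp add: bij_betw_def eq_card_imp_inj_on)
  qed
  let ?p = "\<lambda>k. fst (ps ! (k - 1))" and ?q = "\<lambda>k. snd (ps ! (k - 1))"
  have p: "bij_betw ?p {1..n} {1..n}" and q: "bij_betw ?q {1..n} {1..n}"
    using bij f s by (simp_all add: n_def)
  define v where "v = inv_into {1..n} ?p"
  have v: "bij_betw v {1..n} {1..n}" unfolding v_def by (rule bij_betw_inv_into[OF p])
  have pv: "?p (v i) = i" if "i \<in> {1..n}" for i
    unfolding v_def by (rule bij_betw_inv_into_right[OF p that])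
  \<comment> \<open>Outside the index range the identity is chosen, as \<open>permutes\<close>
    demands.\<close>
  define \<pi> where "\<pi> i = (if i \<in> {1..n} then ?q (v i) else i)" for i
  have "bij_betw \<pi> {1..n} {1..n}"
    using bij_betw_trans[OF v q] by (rule bij_betw_cong[THEN iffD1, rotated]) (simp add: \<pi>_def)
  then have perm: "\<pi> permutes {1..n}"
    by (rule bij_imp_permutes) (simp only: \<pi>_def if_False)
  have adj: "(v i, v j) \<in> parcs (points_graph ps) \<longleftrightarrow> \<pi> i > \<pi> j"
    if "i \<in> {1..n}" "j \<in> {1..n}" "i < j" for i j
  proof -
    have "v i \<in> {1..n}" "v j \<in> {1..n}" using bij_betwE[OF v] that by auto
    then have "(v i, v j) \<in> parcs (points_graph ps) \<longleftrightarrow> crosses (ps ! (v i - 1)) (ps ! (v j - 1))"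
      by (simp add: n_def)
    then show ?thesis using pv[OF that(1)] pv[OF that(2)] that by (simp add: crosses_def \<pi>_def)
  qed
  have V: "pverts (points_graph ps) = {1..n}" by (simp add: n_def)
  have card: "card {1..n} = n" by simp
  show ?thesis
    unfolding permutation_graph_def V card
    by (intro conjI exI[of _ v] exI[of _ \<pi>] ballI impI pair_graph_points_graph v perm adj)
qed

lemma points_graph_cubic:
  assumes "fst ` set ps = {1..length ps}" "snd ` set ps = {1..length ps}" "ps \<noteq> []"
    and deg: "\<And>i. i < length ps \<Longrightarrow> card {j. j < length ps \<and> crosses (ps ! i) (ps ! j)} = 3"
    and "\<And>i. 0 < i \<Longrightarrow> i < length ps \<Longrightarrow> \<exists>j<i. crosses (ps ! i) (ps ! j)"
  shows "points_graph ps \<in> cubic_graphs (length ps)"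
proof -
  have "regular_graph 3 (points_graph ps)"
    unfolding regular_graph_def
  proof
    fix u assume "u \<in> pverts (points_graph ps)"
    then obtain i where "u = Suc i" "i < length ps" by (cases u) auto
    then show "out_degree (with_proj (points_graph ps)) u = 3"
      using out_degree_points_graph deg by simp
  qed
  then show ?thesis
    unfolding connected_cubic_permutation_graphs_def
    using pair_graph_points_graph connected_points_graph permutation_graph_points_graph assms by simp
qed

lemma chain_points_cubic:
  assumes "set w \<subseteq> {2,3}"
  shows "points_graph (chain_points w) \<in> cubic_graphs (length (chain_points w))"
proof (rule points_graph_cubic[OF image_chain_points])
  have nb: "{j. j < length (chain_points w) \<and> crosses (chain_points w ! i) (chain_points w ! j)} =
      nbrs (chain_blocks w) i" if "i < length (chain_points w)" for i
    using that crosses_chain_points by (auto simp: nbrs_def length_chain_points)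
  show "chain_points w \<noteq> []" by (simp add: chain_points_def)
  fix i assume i: "i < length (chain_points w)"
  show "card {j. j < length (chain_points w) \<and> crosses (chain_points w ! i) (chain_points w ! j)} = 3"
    unfolding nb[OF i] using chain_cubic[OF assms] i by (simp add: length_chain_points)
  assume "0 < i"
  then have "\<exists>x\<in>nbrs (chain_blocks w) i. x < i"
    using chain_cubic[OF assms] i by (simp add: length_chain_points)
  then show "\<exists>j<i. crosses (chain_points w ! i) (chain_points w ! j)"
    unfolding nb[OF i, symmetric] by blast
qed

lemma card_crosses_eq_length_filter:
  "card {j. j < length ps \<and> crosses u (ps ! j)} = length (filter (crosses u) ps)"
  by (simp add: length_filter_conv_card)

lemma k4_points_cubic: "points_graph k4_points \<in> cubic_graphs 4"
proof -
  have "points_graph k4_points \<in> cubic_graphs (length k4_points)"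
  proof (rule points_graph_cubic)
    show "fst ` set k4_points = {1..length k4_points}" "snd ` set k4_points = {1..length k4_points}"
      by (auto simp: k4_points_def)
    show "card {j. j < length k4_points \<and> crosses (k4_points ! i) (k4_points ! j)} = 3"
      if "i < length k4_points" for i
    proof -
      have "\<forall>u\<in>set k4_points. length (filter (crosses u) k4_points) = 3"
        by (simp add: k4_points_def crosses_def)
      then show ?thesis unfolding card_crosses_eq_length_filter using that by simp
    qed
    have "\<forall>i<length k4_points. 0 < i \<longrightarrow> crosses (k4_points ! i) (k4_points ! 0)"
      unfolding k4_points_def less_length_Cons_iff by (simp add: crosses_def)
    then show "\<exists>j<i. crosses (k4_points ! i) (k4_points ! j)" if "0 < i" "i < length k4_points" for i
      using that by blast
  qed (simp add: k4_points_def)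
  moreover have "length k4_points = 4" by (simp add: k4_points_def)
  ultimately show ?thesis by simp
qed

lemma k33_points_cubic: "points_graph k33_points \<in> cubic_graphs 6"
proof -
  have "points_graph k33_points \<in> cubic_graphs (length k33_points)"
  proof (rule points_graph_cubic)
    show "fst ` set k33_points = {1..length k33_points}" "snd ` set k33_points = {1..length k33_points}"
      by (auto simp: k33_points_def)
    show "card {j. j < length k33_points \<and> crosses (k33_points ! i) (k33_points ! j)} = 3"
      if "i < length k33_points" for i
    proof -
      have "\<forall>u\<in>set k33_points. length (filter (crosses u) k33_points) = 3"
        by (simp add: k33_points_def crosses_def)
      then show ?thesis unfolding card_crosses_eq_length_filter using that by simp
    qed
    have "\<forall>i<length k33_points. 0 < i \<longrightarrow> crosses (k33_points ! i) (k33_points ! 0)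
        \<or> 1 < i \<and> crosses (k33_points ! i) (k33_points ! 1)"
      unfolding k33_points_def less_length_Cons_iff by (simp add: crosses_def)
    then show "\<exists>j<i. crosses (k33_points ! i) (k33_points ! j)" if "0 < i" "i < length k33_points" for i
      using that by blast
  qed (simp add: k33_points_def)
  moreover have "length k33_points = 6" by (simp add: k33_points_def)
  ultimately show ?thesis by simp
qed

lemma chain_points_iso_rev:
  "pair_iso (\<lambda>i. Suc (length (chain_points w)) - i) (points_graph (chain_points w)) (points_graph (chain_points (rev w)))"
proof -
  define n where "n = length (chain_points w)"
  have n: "length (chain_points (rev w)) = n" "total_size (chain_blocks w) = n"
    by (simp_all add: n_def length_chain_points)
  have "bij_betw (\<lambda>i. Suc n - i) {1..n} {1..n}"
    by (rule bij_betw_byWitness[where f' = "\<lambda>i. Suc n - i"]) auto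
  moreover have "crosses (chain_points (rev w) ! (Suc n - u - 1)) (chain_points (rev w) ! (Suc n - v - 1))
      \<longleftrightarrow> crosses (chain_points w ! (u - 1)) (chain_points w ! (v - 1))"
    if "u \<in> {1..n}" "v \<in> {1..n}" for u v
  proof -
    have eq: "Suc n - u - 1 = n - 1 - (u - 1)" "Suc n - v - 1 = n - 1 - (v - 1)" using that by auto
    have "chain_adj (chain_blocks (rev w)) (n - 1 - (u - 1)) (n - 1 - (v - 1))
        \<longleftrightarrow> chain_adj (chain_blocks w) (u - 1) (v - 1)"
      using chain_adj_rev[of "u - 1" w "v - 1"] that n by auto
    moreover have "u - 1 < n" "v - 1 < n" "n - 1 - (u - 1) < n" "n - 1 - (v - 1) < n" using that by auto
    ultimately show ?thesis
      unfolding eq using crosses_chain_points[of _ w] crosses_chain_points[of _ "rev w"] n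
      by (simp add: n_def[symmetric])
  qed
  ultimately show ?thesis
    unfolding pair_iso_def n_def[symmetric] points_graph_simps n(1) by (auto simp: Suc_diff_le)
qed

lemma chain_points_iso_imp:
  assumes w: "set w \<subseteq> {2,3}" and v: "set v \<subseteq> {2,3}"
    and iso: "pair_iso f (points_graph (chain_points w)) (points_graph (chain_points v))"
  shows "w = v \<or> w = rev v"
proof -
  define n where "n = length (chain_points w)"
  have bij: "bij_betw f {1..n} {1..length (chain_points v)}"
    using iso by (simp add: pair_iso_def n_def)
  then have n': "length (chain_points v) = n" using bij_betw_same_card by fastforce
  note bij = bij[unfolded n']
  have f: "f i \<in> {1..n}" if "i \<in> {1..n}" for i using bij_betwE[OF bij] that by blast
  \<comment> \<open>The isomorphism shifted to numbers from 0 and continued by the identity, so that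
    it is injective on all numbers.\<close>
  define F where "F i = (if i < n then f (Suc i) - 1 else i)" for i
  have Flt: "F i < n \<longleftrightarrow> i < n" for i
    using f[of "Suc i"] by (auto simp: F_def)
  have fF: "f (Suc i) = Suc (F i)" if "i < n" for i
    using f[of "Suc i"] that by (auto simp: F_def)
  have inj: "inj F"
  proof (rule injI)
    fix i j assume ij: "F i = F j"
    show "i = j"
    proof (cases "i < n")
      case True
      then have "j < n" using ij Flt by metis
      then have "f (Suc i) = f (Suc j)" using fF True ij by simp
      then show ?thesis using bij True \<open>j < n\<close> by (auto simp: bij_betw_def dest: inj_onD)
    next
      case False
      then have "\<not> j < n" using ij Flt by metis
      then show ?thesis using ij False by (simp add: F_def)
    qed
  qed
  have surj: "\<exists>j<n. k = F j" if "k < n" for k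
  proof -
    have "Suc k \<in> f ` {1..n}" using bij that by (simp add: bij_betw_def)
    then obtain i where i: "i \<in> {1..n}" "Suc k = f i" by blast
    then have "i - 1 < n" "F (i - 1) = k" using fF[of "i - 1"] by auto
    then show ?thesis by blast
  qed
  have adj: "chain_adj (chain_blocks v) (F i) (F j) \<longleftrightarrow> chain_adj (chain_blocks w) i j"
    if "i < n" "j < n" for i j
  proof -
    have "(f (Suc i), f (Suc j)) \<in> parcs (points_graph (chain_points v)) \<longleftrightarrow>
        (Suc i, Suc j) \<in> parcs (points_graph (chain_points w))"
      using iso that by (simp add: pair_iso_def n_def)
    moreover have "F i < n" "F j < n" using that Flt by auto
    ultimately have "crosses (chain_points v ! F i) (chain_points v ! F j) \<longleftrightarrow>
        crosses (chain_points w ! i) (chain_points w ! j)"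
      using that fF n' by (simp add: n_def[symmetric])
    then show ?thesis
      using crosses_chain_points that \<open>F i < n\<close> \<open>F j < n\<close> n' by (simp add: n_def)
  qed
  have sizes: "total_size (chain_blocks w) = n" "total_size (chain_blocks v) = n"
    using n' by (simp_all add: n_def length_chain_points)
  have "nbrs (chain_blocks v) (F i) = F ` nbrs (chain_blocks w) i" for i
  proof (intro equalityI subsetI)
    fix k assume "k \<in> nbrs (chain_blocks v) (F i)"
    then have k: "i < n" "k < n" "chain_adj (chain_blocks v) (F i) k" by (auto simp: nbrs_def sizes Flt)
    then obtain j where "j < n" "k = F j" using surj by blast
    then show "k \<in> F ` nbrs (chain_blocks w) i" using k adj by (auto simp: nbrs_def sizes)
  next
    fix k assume "k \<in> F ` nbrs (chain_blocks w) i"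
    then show "k \<in> nbrs (chain_blocks v) (F i)" using adj by (auto simp: nbrs_def sizes Flt)
  qed
  then show ?thesis by (rule chain_iso_imp_eq_or_rev[OF w v inj])
qed

text \<open>Connectedness enters the classification only here, as \<open>uncut\<close>.\<close>

lemma cubic_graph_diagram:
  assumes "G \<in> cubic_graphs n"
  obtains v \<pi> where "bij_betw v {1..n} (pverts G)" "cubic_diagram n ((\<lambda>i. (i, \<pi> i)) ` {1..n})"
    "\<And>i j. i \<in> {1..n} \<Longrightarrow> j \<in> {1..n} \<Longrightarrow> (v i, v j) \<in> parcs G \<longleftrightarrow> crosses (i, \<pi> i) (j, \<pi> j)"
proof -
  have G: "pair_graph G" "pverts G = {1..n}" "connected (with_proj G)" "regular_graph 3 G" "permutation_graph G"
    using assms by (simp_all add: connected_cubic_permutation_graphs_def)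
  interpret pair_graph G by (rule G(1))
  have card: "card (pverts G) = n" by (simp add: G(2))
  obtain v \<pi> where v: "bij_betw v {1..n} (pverts G)" and \<pi>: "\<pi> permutes {1..n}"
    and lt: "\<forall>i\<in>{1..n}. \<forall>j\<in>{1..n}. i < j \<longrightarrow> ((v i, v j) \<in> parcs G \<longleftrightarrow> \<pi> i > \<pi> j)"
    using G(5) unfolding permutation_graph_def card by blast
  have sym: "(a, b) \<in> parcs G \<longleftrightarrow> (b, a) \<in> parcs G" for a b
    using pair_sym_arcs by (auto simp: symmetric_def dest: symD)
  have adj: "(v i, v j) \<in> parcs G \<longleftrightarrow> crosses (i, \<pi> i) (j, \<pi> j)" if "i \<in> {1..n}" "j \<in> {1..n}" for i j
  proof (cases i j rule: linorder_cases)
    case less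
    then show ?thesis using lt that by (simp add: crosses_def)
  next
    case equal
    then show ?thesis using pair_no_loops[of "(v i, v j)"] by (auto simp: crosses_def)
  next
    case greater
    then have "(v j, v i) \<in> parcs G \<longleftrightarrow> \<pi> j > \<pi> i" using lt that by blast
    then show ?thesis using sym greater by (simp add: crosses_def)
  qed
  define U where "U = (\<lambda>i. (i, \<pi> i)) ` {1..n}"
  have inj\<pi>: "inj \<pi>" by (rule permutes_inj[OF \<pi>])
  have deg: "card {x\<in>U. crosses u x} = 3" if u: "u \<in> U" for u
  proof -
    obtain i where i: "i \<in> {1..n}" "u = (i, \<pi> i)" using u by (auto simp: U_def)
    have "out_arcs (with_proj G) (v i) = (\<lambda>x. (v i, v (fst x))) ` {x\<in>U. crosses u x}" (is "?L = ?R")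
    proof (intro equalityI subsetI)
      fix e assume "e \<in> ?L"
      then obtain b where b: "e = (v i, b)" "(v i, b) \<in> parcs G" by (cases e) (auto simp: out_arcs_def)
      then have "b \<in> v ` {1..n}" using in_arcsD2 v by (auto simp: bij_betw_def)
      then obtain j where j: "j \<in> {1..n}" "b = v j" by blast
      then have "(j, \<pi> j) \<in> {x\<in>U. crosses u x}" using adj[OF i(1) j(1)] b i by (auto simp: U_def)
      then show "e \<in> ?R" using b j by force
    next
      fix e assume "e \<in> ?R"
      then show "e \<in> ?L" using adj i by (auto simp: out_arcs_def U_def)
    qed
    moreover have "inj_on (\<lambda>x. (v i, v (fst x))) {x\<in>U. crosses u x}"
      using v by (auto simp: inj_on_def bij_betw_def U_def)
    ultimately have "card {x\<in>U. crosses u x} = out_degree (with_proj G) (v i)"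
      by (simp add: out_degree_def card_image)
    also have "\<dots> = 3" using G(4) bij_betwE[OF v] i(1) by (simp add: regular_graph_def)
    finally show ?thesis .
  qed
  \<comment> \<open>If \<pi> respects the level \<open>m\<close>, no crossing pair has indices on
    both sides of it, so no path leads from \<open>v 1\<close> to \<open>v n\<close>.\<close>
  have cut: False if m: "0 < m" "m < n" and closed: "\<And>i. i \<in> {1..n} \<Longrightarrow> i \<le> m \<longleftrightarrow> \<pi> i \<le> m" for m
  proof -
    have "v 1 \<in> pverts G" "v n \<in> pverts G" using bij_betwE[OF v] m by auto
    moreover have "strongly_connected (with_proj G)"
      using symmetric_connected_imp_strongly_connected[OF pair_sym_arcs G(3)] .
    ultimately have "v 1 \<rightarrow>\<^sup>*\<^bsub>with_proj G\<^esub> v n" by (simp add: strongly_connected_def)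
    then have "v n \<in> v ` {1..m}"
    proof (induction rule: reachable_induct)
      case base
      then show ?case using m by auto
    next
      case (step x y)
      then obtain i where i: "i \<in> {1..m}" "x = v i" by blast
      have "y \<in> v ` {1..n}" using step in_arcsD2 v by (auto simp: bij_betw_def)
      then obtain j where j: "j \<in> {1..n}" "y = v j" by blast
      have "i \<in> {1..n}" using i m by auto
      moreover have "crosses (i, \<pi> i) (j, \<pi> j)" using adj[of i j] step i j m by auto
      ultimately have "j \<le> m" using closed[of i] closed[of j] i j(1) by (auto simp: crosses_def)
      then show ?case using j by auto
    qed
    then obtain i where "i \<in> {1..m}" "v n = v i" by blast
    then have "n = i" using v m by (auto simp: bij_betw_def dest: inj_onD)
    then show False using \<open>i \<in> {1..m}\<close> m by simp
  qed
  \<comment> \<open>If either witness is missing, \<pi> permutes \<open>{1..m}\<close>: by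
    injectivity in the first half, by surjectivity and cardinality in the second.\<close>
  have "\<exists>i\<in>{1..n}. i \<le> m \<and> m < \<pi> i" "\<exists>i\<in>{1..n}. \<pi> i \<le> m \<and> m < i" if m: "0 < m" "m < n" for m
  proof -
    have sub: "{1..m} \<subseteq> {1..n}" using m by auto
    have \<pi>n: "\<pi> i \<in> {1..n}" if "i \<in> {1..n}" for i
      using permutes_in_image[OF \<pi>] that by blast
    show "\<exists>i\<in>{1..n}. i \<le> m \<and> m < \<pi> i"
    proof (rule ccontr)
      assume no: "\<not> ?thesis"
      have "\<pi> ` {1..m} \<subseteq> {1..m}" using no \<pi>n sub by (fastforce simp: not_less)
      then have eq: "\<pi> ` {1..m} = {1..m}"
        by (intro endo_inj_surj) (auto intro: inj_on_subset[OF inj\<pi>])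
      have "i \<le> m \<longleftrightarrow> \<pi> i \<le> m" if "i \<in> {1..n}" for i
      proof -
        have "i \<in> {1..m} \<longleftrightarrow> \<pi> i \<in> {1..m}" using eq inj_image_mem_iff[OF inj\<pi>, of i "{1..m}"] by simp
        then show ?thesis using that \<pi>n[OF that] by auto
      qed
      then show False by (rule cut[OF m])
    qed
    show "\<exists>i\<in>{1..n}. \<pi> i \<le> m \<and> m < i"
    proof (rule ccontr)
      assume no: "\<not> ?thesis"
      have "{1..m} \<subseteq> \<pi> ` {1..m}"
      proof
        fix k assume k: "k \<in> {1..m}"
        then have "k \<in> \<pi> ` {1..n}" using permutes_image[OF \<pi>] sub by blast
        then obtain i where i: "i \<in> {1..n}" "k = \<pi> i" by blast
        then have "i \<le> m" using no k by (auto simp: not_less)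
        then show "k \<in> \<pi> ` {1..m}" using i by auto
      qed
      then have eq: "\<pi> ` {1..m} = {1..m}"
        using card_image_le[of "{1..m}" \<pi>] by (intro card_seteq[symmetric]) simp_all
      have "i \<le> m \<longleftrightarrow> \<pi> i \<le> m" if "i \<in> {1..n}" for i
      proof -
        have "i \<in> {1..m} \<longleftrightarrow> \<pi> i \<in> {1..m}" using eq inj_image_mem_iff[OF inj\<pi>, of i "{1..m}"] by simp
        then show ?thesis using that \<pi>n[OF that] by auto
      qed
      then show False by (rule cut[OF m])
    qed
  qed
  then have "uncut 0 n U" by (simp add: uncut_def U_def)
  moreover have "fst ` U = {1..n}" "snd ` U = {1..n}"
    using permutes_image[OF \<pi>] by (simp_all add: U_def image_image)
  moreover have "inj_on fst U" "inj_on snd U"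
    using inj\<pi> by (auto simp: U_def inj_on_def)
  ultimately have "cubic_diagram n U"
    using deg by (simp add: cubic_diagram_def U_def)
  then show thesis using that v adj unfolding U_def by blast
qed

lemma diagram_points_iso:
  assumes v: "bij_betw v {1..n} (pverts G)"
    and adj: "\<And>i j. i \<in> {1..n} \<Longrightarrow> j \<in> {1..n} \<Longrightarrow> (v i, v j) \<in> parcs G \<longleftrightarrow> crosses (i, \<pi> i) (j, \<pi> j)"
    and ps: "set ps = (\<lambda>i. (i, \<pi> i)) ` {1..n}" "length ps = n"
  shows "pair_iso (\<lambda>k. v (fst (ps ! (k - 1)))) (points_graph ps) G"
proof -
  let ?p = "\<lambda>k. fst (ps ! (k - 1))"
  have mem: "ps ! (k - 1) = (?p k, \<pi> (?p k)) \<and> ?p k \<in> {1..n}" if "k \<in> {1..n}" for k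
  proof -
    have "ps ! (k - 1) \<in> set ps" using that ps(2) by auto
    then show ?thesis unfolding ps(1) by auto
  qed
  have "?p ` {1..n} = {1..n}"
  proof (intro equalityI subsetI)
    fix i assume "i \<in> {1..n}"
    then have "(i, \<pi> i) \<in> set ps" unfolding ps(1) by blast
    then obtain k where "k < n" "ps ! k = (i, \<pi> i)" using ps(2) by (auto simp: in_set_conv_nth)
    then show "i \<in> ?p ` {1..n}" by (intro image_eqI[of _ _ "Suc k"]) auto
  qed (use mem in blast)
  then have p: "bij_betw ?p {1..n} {1..n}" by (simp add: bij_betw_def eq_card_imp_inj_on)
  have "(v (?p i), v (?p j)) \<in> parcs G \<longleftrightarrow> (i, j) \<in> parcs (points_graph ps)"
    if "i \<in> {1..n}" "j \<in> {1..n}" for i j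
    using adj[of "?p i" "?p j"] mem[OF that(1)] mem[OF that(2)] that ps(2) by simp
  then show ?thesis
    using bij_betw_trans[OF p v] ps(2) by (simp add: pair_iso_def comp_def)
qed

lemma length_distinct_points:
  assumes "cubic_diagram n U" "set ps = U" "distinct ps"
  shows "length ps = n"
proof -
  have "length ps = card U" using assms(2,3) distinct_card by fastforce
  also have "\<dots> = card (fst ` U)"
    using assms(1) unfolding cubic_diagram_def by (intro card_image[symmetric]) blast
  also have "fst ` U = {1..n}" using assms(1) unfolding cubic_diagram_def by blast
  finally show ?thesis by simp
qed

lemma distinct_chain_points: "distinct (chain_points w)"
proof -
  have "card (fst ` set (chain_points w)) = length (chain_points w)"
    by (simp add: image_chain_points(1))
  then have "distinct (map fst (chain_points w))" by (intro card_distinct) simp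
  then show ?thesis by (simp add: distinct_map)
qed

lemma cubic_graph_classification:
  assumes "G \<in> cubic_graphs n" "n > 0"
  obtains ps f where "pair_iso f (points_graph ps) G" "length ps = n"
    "ps = k4_points \<or> ps = k33_points \<or> (\<exists>w. set w \<subseteq> {2,3} \<and> ps = chain_points w)"
proof -
  obtain v \<pi> where v: "bij_betw v {1..n} (pverts G)"
    and U: "cubic_diagram n ((\<lambda>i. (i, \<pi> i)) ` {1..n})" (is "cubic_diagram n ?U")
    and adj: "\<And>i j. i \<in> {1..n} \<Longrightarrow> j \<in> {1..n} \<Longrightarrow> (v i, v j) \<in> parcs G \<longleftrightarrow> crosses (i, \<pi> i) (j, \<pi> j)"
    using cubic_graph_diagram[OF assms(1)] by blast
  have *: "\<exists>f. pair_iso f (points_graph ps) G \<and> length ps = n" if "?U = set ps" "distinct ps" for ps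
  proof -
    have "length ps = n" using length_distinct_points[OF U] that by simp
    then show ?thesis using diagram_points_iso[OF v adj that(1)[symmetric]] by blast
  qed
  from U assms(2) show thesis
  proof (cases rule: cubic_diagram_classification)
    case 1
    then show thesis using *[of k4_points] that by (auto simp: k4_points_def)
  next
    case 2
    then show thesis using *[of k33_points] that by (auto simp: k33_points_def)
  next
    case (3 w)
    then show thesis using *[of "chain_points w"] that distinct_chain_points by blast
  next
    case (4 w)
    let ?ps = "map prod.swap (chain_points w)"
    have "?U = set ?ps" using 4 by simp
    moreover have "distinct ?ps" using distinct_chain_points by (simp add: distinct_map)
    ultimately obtain f where "pair_iso f (points_graph ?ps) G" "length ?ps = n" using * by blast
    \<comment> \<open>A transposed chain diagram has the same graph, so the fourth case yields
      nothing new.\<close>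
    then show thesis using that[of f "chain_points w"] 4 unfolding points_graph_swap by auto
  qed
qed

section \<open>Compositions up to reversal\<close>

text \<open>Burnside's count for a group of order two: orbits have size 2 except at fixed
  points.\<close>

lemma card_involution_orbits:
  assumes fin: "finite A" and r: "\<And>x. x \<in> A \<Longrightarrow> r x \<in> A" "\<And>x. x \<in> A \<Longrightarrow> r (r x) = x"
  shows "2 * card ((\<lambda>x. {x, r x}) ` A) = card A + card {x\<in>A. r x = x}"
proof -
  define S where "S = (\<lambda>x. {x, r x}) ` A"
  define F where "F = {x\<in>A. r x = x}"
  define S1 where "S1 = (\<lambda>x. {x}) ` F"
  have S1: "S1 \<subseteq> S" by (auto simp: S1_def S_def F_def image_iff)
  have finS: "finite S" using fin by (simp add: S_def)
  have two: "card X = 2" if X: "X \<in> S - S1" for X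
  proof -
    obtain x where x: "x \<in> A" "X = {x, r x}" using X by (auto simp: S_def)
    then have "r x \<noteq> x" using X by (auto simp: S1_def F_def)
    then show ?thesis using x by auto
  qed
  have one: "card X = 1" if "X \<in> S1" for X using that by (auto simp: S1_def)
  have disj: "pairwise disjnt S"
  proof (rule pairwiseI)
    fix X Y assume "X \<in> S" "Y \<in> S" "X \<noteq> Y"
    then obtain x y where xy: "x \<in> A" "y \<in> A" "X = {x, r x}" "Y = {y, r y}" by (auto simp: S_def)
    have rr: "r (r x) = x" "r (r y) = y" using r(2) xy by auto
    have "x \<noteq> y" "x \<noteq> r y" "r x \<noteq> y" using \<open>X \<noteq> Y\<close> xy rr by auto
    moreover have "r x \<noteq> r y" using \<open>x \<noteq> y\<close> rr by metis
    ultimately show "disjnt X Y" using xy by (auto simp: disjnt_def)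
  qed
  have "\<Union>S = A" using r(1) by (auto simp: S_def)
  then have "card A = sum card S"
    using card_Union_disjoint[OF disj] by (auto simp: S_def)
  also have "\<dots> = sum card (S - S1) + sum card S1" by (rule sum.subset_diff[OF S1 finS])
  also have "\<dots> = 2 * card (S - S1) + card S1" using one two by simp
  finally have "card A = 2 * (card S - card S1) + card S1"
    using card_Diff_subset[OF finite_subset[OF S1 finS] S1] by simp
  moreover have "card S1 = card F" by (simp add: S1_def card_image)
  moreover have "card S1 \<le> card S" by (rule card_mono[OF finS S1])
  ultimately show ?thesis by (simp add: S_def F_def)
qed

lemma compositions_2_3_rec:
  "compositions_2_3 m = (if m = 0 then {[]} else
     (if 2 \<le> m then Cons 2 ` compositions_2_3 (m - 2) else {}) \<union>
     (if 3 \<le> m then Cons 3 ` compositions_2_3 (m - 3) else {}))" (is "_ = ?R")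
proof (rule set_eqI)
  fix w
  show "w \<in> compositions_2_3 m \<longleftrightarrow> w \<in> ?R"
  proof (cases w)
    case (Cons a u)
    have "a # u \<in> ?R \<longleftrightarrow> a \<in> {2,3} \<and> set u \<subseteq> {2,3} \<and> a + sum_list u = m"
      by (auto simp: compositions_2_3_def image_iff simp del: sum_list_eq_0_iff)
    then show ?thesis using Cons by (auto simp: compositions_2_3_def simp del: sum_list_eq_0_iff)
  qed (auto simp: compositions_2_3_def)
qed

lemma compositions_2_3_base:
  "compositions_2_3 0 = {[]}" "compositions_2_3 1 = {}" "compositions_2_3 2 = {[2]}" "compositions_2_3 3 = {[3]}"
proof -
  show 0: "compositions_2_3 0 = {[]}" and 1: "compositions_2_3 1 = {}"
    using compositions_2_3_rec[of 0] compositions_2_3_rec[of 1] by simp_all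
  show "compositions_2_3 2 = {[2]}" "compositions_2_3 3 = {[3]}"
    using compositions_2_3_rec[of 2] compositions_2_3_rec[of 3] 0 1 by simp_all
qed

lemma finite_compositions_2_3: "finite (compositions_2_3 m)"
proof (induction m rule: less_induct)
  case (less m)
  then show ?case by (subst compositions_2_3_rec) auto
qed

lemma card_compositions_2_3_rec:
  assumes "3 \<le> m"
  shows "card (compositions_2_3 m) = card (compositions_2_3 (m - 2)) + card (compositions_2_3 (m - 3))"
proof -
  have "compositions_2_3 m = Cons 2 ` compositions_2_3 (m - 2) \<union> Cons 3 ` compositions_2_3 (m - 3)"
    using compositions_2_3_rec[of m] assms by simp
  moreover have "Cons 2 ` compositions_2_3 (m - 2) \<inter> Cons 3 ` compositions_2_3 (m - 3) = {}" by auto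
  ultimately have "card (compositions_2_3 m) =
      card (Cons 2 ` compositions_2_3 (m - 2)) + card (Cons 3 ` compositions_2_3 (m - 3))"
    using finite_compositions_2_3 by (simp add: card_Un_disjoint)
  then show ?thesis by (simp add: card_image)
qed

definition palindromes :: "nat \<Rightarrow> nat list set" where
  "palindromes m = {w\<in>compositions_2_3 m. rev w = w}"

lemma finite_palindromes: "finite (palindromes m)"
  using finite_compositions_2_3 by (simp add: palindromes_def)

text \<open>\<open>4 \<le> m\<close> excludes words of length at most 1, so a palindrome has two
  equal outer parts to strip.\<close>

lemma palindromes_rec:
  assumes "4 \<le> m"
  shows "palindromes m = (\<lambda>u. 2 # u @ [2]) ` palindromes (m - 4) \<union>
    (if 6 \<le> m then (\<lambda>u. 3 # u @ [3]) ` palindromes (m - 6) else {})" (is "_ = ?R")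
proof (intro equalityI subsetI)
  fix w assume "w \<in> palindromes m"
  then have w: "set w \<subseteq> {2,3}" "sum_list w = m" "rev w = w" by (auto simp: palindromes_def compositions_2_3_def)
  obtain a v where av: "w = a # v" using w assms by (cases w) auto
  have "v \<noteq> []" using w av assms by auto
  then have "v = butlast v @ [last v]" by simp
  then obtain u b where ub: "v = u @ [b]" by blast
  have "rev (a # u @ [b]) = b # rev u @ [a]" by simp
  then have "b # rev u @ [a] = a # u @ [b]" using w(3) unfolding av ub by (rule subst)
  then have b: "b = a" and u: "rev u = u" unfolding list.inject append1_eq_conv by blast+
  have sum: "m = 2 * a + sum_list u" using w(2) unfolding av ub b by simp
  have set_u: "set u \<subseteq> {2,3}" and a: "a = 2 \<or> a = 3" using w(1) unfolding av ub by auto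
  have "u \<in> palindromes (m - 2 * a)" using u set_u sum by (simp add: palindromes_def compositions_2_3_def)
  moreover have "w = a # u @ [a]" using av ub b by simp
  moreover have "2 * a \<le> m" using sum by simp
  ultimately show "w \<in> ?R" using a by auto
next
  fix w assume "w \<in> ?R"
  then show "w \<in> palindromes m"
    using assms by (auto simp: palindromes_def compositions_2_3_def split: if_splits)
qed

lemma card_palindromes_rec:
  assumes "4 \<le> m"
  shows "card (palindromes m) = card (palindromes (m - 4)) + (if 6 \<le> m then card (palindromes (m - 6)) else 0)"
proof -
  have "inj_on (\<lambda>u. a # u @ [a]) B" for a :: nat and B by (auto simp: inj_on_def)
  moreover have "(\<lambda>u. 2 # u @ [2::nat]) ` B \<inter> (\<lambda>u. 3 # u @ [3]) ` C = {}" for B C by auto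
  ultimately show ?thesis
    using finite_palindromes by (auto simp: palindromes_rec[OF assms] card_Un_disjoint card_image)
qed

lemma card_palindromes_base:
  "card (palindromes 0) = 1" "card (palindromes 1) = 0" "card (palindromes 2) = 1" "card (palindromes 3) = 1"
proof -
  have "palindromes 0 = {[]}" "palindromes 1 = {}" "palindromes 2 = {[2]}" "palindromes 3 = {[3]}"
    unfolding palindromes_def compositions_2_3_base by auto
  then show "card (palindromes 0) = 1" "card (palindromes 1) = 0" "card (palindromes 2) = 1" "card (palindromes 3) = 1"
    by simp_all
qed

text \<open>A palindrome of even sum either has no middle part, and its half is a composition of
  \<open>h\<close>, or has middle part 2, and its half is one of \<open>h - 1\<close>. The proof
  compares recurrences: both sides satisfy x(h) = x(h-2) + x(h-3).\<close>

lemma card_palindromes_even: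
  "card (palindromes (2 * h)) = card (compositions_2_3 h) + (if h = 0 then 0 else card (compositions_2_3 (h - 1)))"
proof (induction h rule: less_induct)
  case (less h)
  show ?case
  proof (cases "h < 4")
    case True
    then consider "h = 0" | "h = 1" | "h = 2" | "h = 3" by linarith
    then show ?thesis
      using card_palindromes_rec[of 4] card_palindromes_rec[of 6]
      by cases (simp_all add: card_palindromes_base compositions_2_3_base compositions_2_3_base[unfolded One_nat_def] card_palindromes_base[unfolded One_nat_def])
  next
    case False
    have eq: "2 * h - 4 = 2 * (h - 2)" "2 * h - 6 = 2 * (h - 3)" by auto
    have "card (palindromes (2 * h)) = card (palindromes (2 * (h - 2))) + card (palindromes (2 * (h - 3)))"
      using card_palindromes_rec[of "2 * h"] False unfolding eq by simp
    \<comment> \<open>This instance needs \<open>3 \<le> h - 1\<close>, whence the base cases up to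
      \<open>h = 3\<close>.\<close>
    moreover have "card (compositions_2_3 (h - 1)) = card (compositions_2_3 (h - 3)) + card (compositions_2_3 (h - 4))"
      using card_compositions_2_3_rec[of "h - 1"] False by (simp add: numeral_eq_Suc)
    ultimately show ?thesis
      using less.IH[of "h - 2"] less.IH[of "h - 3"] False card_compositions_2_3_rec[of h] by simp
  qed
qed

text \<open>An odd sum forces the middle part 3, and the half is a composition of
  \<open>h\<close>.\<close>

lemma card_palindromes_odd: "card (palindromes (2 * h + 3)) = card (compositions_2_3 h)"
proof (induction h rule: less_induct)
  case (less h)
  show ?case
  proof (cases "h < 3")
    case True
    then consider "h = 0" | "h = 1" | "h = 2" by linarith
    then show ?thesis
      using card_palindromes_rec[of 5] card_palindromes_rec[of 7]
      by cases (simp_all add: card_palindromes_base compositions_2_3_base compositions_2_3_base[unfolded One_nat_def] card_palindromes_base[unfolded One_nat_def])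
  next
    case False
    have eq: "2 * h + 3 - 4 = 2 * (h - 2) + 3" "2 * h + 3 - 6 = 2 * (h - 3) + 3" using False by auto
    have "card (palindromes (2 * h + 3)) = card (palindromes (2 * (h - 2) + 3)) + card (palindromes (2 * (h - 3) + 3))"
      using card_palindromes_rec[of "2 * h + 3"] False unfolding eq by simp
    then show ?thesis
      using less.IH[of "h - 2"] less.IH[of "h - 3"] False card_compositions_2_3_rec[of h] by simp
  qed
qed

definition reversal_classes :: "nat \<Rightarrow> nat list set set" where
  "reversal_classes m = (\<lambda>w. {w, rev w}) ` compositions_2_3 m"

lemma card_reversal_classes:
  "2 * card (reversal_classes m) = card (compositions_2_3 m) + card (palindromes m)"
  unfolding reversal_classes_def palindromes_def
  by (rule card_involution_orbits[OF finite_compositions_2_3]) (auto simp: compositions_2_3_def)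

lemma card_reversal_classes_base:
  "card (reversal_classes 0) = 1" "card (reversal_classes 1) = 0" "card (reversal_classes 2) = 1"
  "card (reversal_classes 3) = 1" "card (reversal_classes 4) = 1" "card (reversal_classes 5) = 1"
proof -
  have t: "card (compositions_2_3 0) = 1" "card (compositions_2_3 1) = 0" "card (compositions_2_3 2) = 1"
    "card (compositions_2_3 3) = 1"
    unfolding compositions_2_3_base by simp_all
  have t45: "card (compositions_2_3 4) = 1" "card (compositions_2_3 5) = 2"
    using card_compositions_2_3_rec[of 4] card_compositions_2_3_rec[of 5] t t[unfolded One_nat_def] by simp_all
  have p45: "card (palindromes 4) = 1" "card (palindromes 5) = 0"
    using card_palindromes_rec[of 4] card_palindromes_rec[of 5]
      card_palindromes_base card_palindromes_base[unfolded One_nat_def] by simp_all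
  show "card (reversal_classes 0) = 1" "card (reversal_classes 1) = 0" "card (reversal_classes 2) = 1"
    "card (reversal_classes 3) = 1" "card (reversal_classes 4) = 1" "card (reversal_classes 5) = 1"
    using card_reversal_classes[of 0] card_reversal_classes[of 1] card_reversal_classes[of 2]
      card_reversal_classes[of 3] card_reversal_classes[of 4] card_reversal_classes[of 5]
      t t45 p45 card_palindromes_base by linarith+
qed

text \<open>With m = 2 h and c counting compositions, the palindrome counts for m, m-2, m-3 are c(h)
  + c(h-1), c(h-1) + c(h-2) and c(h-3); the first is the sum of the others by c(h) = c(h-2) +
  c(h-3).\<close>

lemma card_reversal_classes_even:
  assumes "6 \<le> m" "even m"
  shows "card (reversal_classes m) = card (reversal_classes (m - 2)) + card (reversal_classes (m - 3))"
proof -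
  obtain h where h: "m = 2 * h" using assms(2) by (rule evenE)
  have h3: "3 \<le> h" using assms h by simp
  have eq: "m - 2 = 2 * (h - 1)" "m - 3 = 2 * (h - 3) + 3" using h h3 by auto
  have "card (palindromes m) = card (palindromes (m - 2)) + card (palindromes (m - 3))"
  proof -
    have "card (palindromes m) = card (compositions_2_3 h) + card (compositions_2_3 (h - 1))"
      unfolding h card_palindromes_even using h3 by simp
    moreover have "card (palindromes (m - 2)) = card (compositions_2_3 (h - 1)) + card (compositions_2_3 (h - 2))"
      unfolding eq(1) card_palindromes_even using h3 by (simp add: numeral_2_eq_2)
    moreover have "card (palindromes (m - 3)) = card (compositions_2_3 (h - 3))"
      unfolding eq(2) card_palindromes_odd ..
    ultimately show ?thesis using card_compositions_2_3_rec[OF h3] by simp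
  qed
  then show ?thesis
    using card_reversal_classes[of m] card_reversal_classes[of "m - 2"] card_reversal_classes[of "m - 3"]
      card_compositions_2_3_rec[of m] assms(1) by linarith
qed

text \<open>With m = 2 h + 3 the palindrome counts for m, m-2, m-3 are c(h), c(h-1) and c(h) +
  c(h-1). The excess 2 c(h-1) is halved in passing to classes.\<close>

lemma card_reversal_classes_odd:
  assumes "6 \<le> m" "odd m"
  shows "card (reversal_classes m) + card (compositions_2_3 ((m - 5) div 2))
    = card (reversal_classes (m - 2)) + card (reversal_classes (m - 3))"
proof -
  obtain k where k: "m = 2 * k + 1" using assms(2) by (rule oddE)
  obtain h where h: "m = 2 * h + 3" "2 \<le> h" using that[of "k - 1"] k assms(1) by simp
  have eq: "m - 2 = 2 * (h - 1) + 3" "m - 3 = 2 * h" "(m - 5) div 2 = h - 1" using h by auto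
  have "card (palindromes m) + 2 * card (compositions_2_3 ((m - 5) div 2))
      = card (palindromes (m - 2)) + card (palindromes (m - 3))"
  proof -
    have "card (palindromes m) = card (compositions_2_3 h)"
      unfolding h(1) card_palindromes_odd ..
    moreover have "card (palindromes (m - 2)) = card (compositions_2_3 (h - 1))"
      unfolding eq(1) card_palindromes_odd ..
    moreover have "card (palindromes (m - 3)) = card (compositions_2_3 h) + card (compositions_2_3 (h - 1))"
      unfolding eq(2) card_palindromes_even using h(2) by simp
    ultimately show ?thesis unfolding eq(3) by simp
  qed
  then show ?thesis
    using card_reversal_classes[of m] card_reversal_classes[of "m - 2"] card_reversal_classes[of "m - 3"]
      card_compositions_2_3_rec[of m] assms(1) by linarith
qed

section \<open>The number of graphs\<close>

text \<open>Reduces counting graphs to counting codes of the finitely described point lists; the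
  classification is used once, here.\<close>

lemma num_graphs_eq_card_codes:
  assumes "n > 0" and mem: "\<And>c. c \<in> C \<Longrightarrow> points_graph (g c) \<in> cubic_graphs n"
    and sur: "\<And>ps. length ps = n \<Longrightarrow>
        ps = k4_points \<or> ps = k33_points \<or> (\<exists>w. set w \<subseteq> {2,3} \<and> ps = chain_points w) \<Longrightarrow> ps \<in> g ` C"
    and ker: "\<And>c d. c \<in> C \<Longrightarrow> d \<in> C \<Longrightarrow>
        (\<exists>f. pair_iso f (points_graph (g c)) (points_graph (g d))) \<longleftrightarrow> h c = h d"
  shows "num_connected_cubic_permutation_graphs n = card (h ` C)"
  unfolding num_connected_cubic_permutation_graphs_def iso_on_def[symmetric]
proof (rule card_quotient_by_codes[OF equiv_iso_on])
  fix G assume G: "G \<in> cubic_graphs n"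
  obtain ps f where ps: "pair_iso f (points_graph ps) G" "length ps = n"
    "ps = k4_points \<or> ps = k33_points \<or> (\<exists>w. set w \<subseteq> {2,3} \<and> ps = chain_points w)"
    by (rule cubic_graph_classification[OF G \<open>n > 0\<close>])
  then obtain c where c: "c \<in> C" "ps = g c" using sur by blast
  then have "(G, points_graph (g c)) \<in> iso_on n"
    using G mem[OF c(1)] pair_iso_inv[OF ps(1)] by (auto simp: iso_on_iff)
  then show "\<exists>c\<in>C. (G, points_graph (g c)) \<in> iso_on n" using c by blast
qed (use mem ker in \<open>auto simp: iso_on_iff\<close>)

lemma length_special_points: "length k4_points = 4" "length k33_points = 6"
  by (simp_all add: k4_points_def k33_points_def)

lemma length_chain_points_sum:
  "set w \<subseteq> {2,3} \<Longrightarrow> length (chain_points w) = 10 + 2 * sum_list w"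
  by (simp add: length_chain_points chain_size)

text \<open>Chains have at least 10 points and the K33 diagram has 6, so a single code
  suffices.\<close>

lemma num_graphs_4: "num_connected_cubic_permutation_graphs 4 = 1"
  using num_graphs_eq_card_codes[of 4 "{()}" "\<lambda>_. k4_points" id]
    pair_iso_id k4_points_cubic length_special_points length_chain_points_sum by fastforce

lemma num_graphs_6: "num_connected_cubic_permutation_graphs 6 = 1"
  using num_graphs_eq_card_codes[of 6 "{()}" "\<lambda>_. k33_points" id]
    pair_iso_id k33_points_cubic length_special_points length_chain_points_sum by fastforce

lemma num_graphs_chain:
  "num_connected_cubic_permutation_graphs (10 + 2 * m) = card (reversal_classes m)"
  unfolding reversal_classes_def
proof (rule num_graphs_eq_card_codes)
  fix w assume "w \<in> compositions_2_3 m"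
  then show "points_graph (chain_points w) \<in> cubic_graphs (10 + 2 * m)"
    using chain_points_cubic[of w] length_chain_points_sum[of w] by (simp add: compositions_2_3_def)
next
  fix ps assume l: "length ps = 10 + 2 * m"
    and "ps = k4_points \<or> ps = k33_points \<or> (\<exists>w. set w \<subseteq> {2,3} \<and> ps = chain_points w)"
  then obtain w where "set w \<subseteq> {2,3}" "ps = chain_points w" using length_special_points by auto
  then have "ps = chain_points w" "w \<in> compositions_2_3 m"
    using l length_chain_points_sum[of w] by (simp_all add: compositions_2_3_def)
  then show "ps \<in> chain_points ` compositions_2_3 m" by blast
next
  fix w v assume "w \<in> compositions_2_3 m" "v \<in> compositions_2_3 m"
  then have wv: "set w \<subseteq> {2,3}" "set v \<subseteq> {2,3}" by (auto simp: compositions_2_3_def)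
  show "(\<exists>f. pair_iso f (points_graph (chain_points w)) (points_graph (chain_points v)))
      \<longleftrightarrow> {w, rev w} = {v, rev v}"
  proof
    assume "\<exists>f. pair_iso f (points_graph (chain_points w)) (points_graph (chain_points v))"
    then have "w = v \<or> w = rev v" using chain_points_iso_imp[OF wv] by blast
    then show "{w, rev w} = {v, rev v}" by auto
  next
    assume "{w, rev w} = {v, rev v}"
    then have "v = w \<or> v = rev w" by auto
    then show "\<exists>f. pair_iso f (points_graph (chain_points w)) (points_graph (chain_points v))"
      using pair_iso_id chain_points_iso_rev by blast
  qed
qed simp

lemma num_graphs_other:
  assumes "n > 0" "n \<noteq> 4" "n \<noteq> 6" "\<And>m. n \<noteq> 10 + 2 * m"
  shows "num_connected_cubic_permutation_graphs n = 0"
proof -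
  have "num_connected_cubic_permutation_graphs n = card (id ` ({} :: (nat \<times> nat) list set))"
  proof (rule num_graphs_eq_card_codes[where g = id])
    fix ps assume "length ps = n"
      "ps = k4_points \<or> ps = k33_points \<or> (\<exists>w. set w \<subseteq> {2,3} \<and> ps = chain_points w)"
    then show "ps \<in> id ` {}" using assms length_special_points length_chain_points_sum by auto
  qed (use assms in auto)
  then show ?thesis by simp
qed

theorem theorem1p3:
  fixes n :: nat and a t :: "nat \<Rightarrow> nat"
  defines "a \<equiv> num_connected_cubic_permutation_graphs"
    and "t \<equiv> \<lambda>x. card (compositions_2_3 x)"
  assumes "n > 0"
  shows "(odd n \<or> n \<in> {2, 8, 12} \<longrightarrow> a n = 0) \<and>
    (n \<in> {4, 6, 10, 14, 16, 18, 20} \<longrightarrow> a n = 1) \<and>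
    (even n \<and> n > 20 \<longrightarrow>
      (n mod 4 = 2 \<longrightarrow> int (a n) = int (a (n - 4)) + int (a (n - 6))) \<and>
      (n mod 4 = 0 \<longrightarrow>
        int (a n) = int (a (n - 4)) + int (a (n - 6)) - int (t ((n - 20) div 4))))"
proof (intro conjI impI)
  have chain: "a (10 + 2 * m) = card (reversal_classes m)" for m
    unfolding a_def by (rule num_graphs_chain)
  assume "odd n \<or> n \<in> {2, 8, 12}"
  then consider "n = 12" | "odd n \<or> n = 2 \<or> n = 8" by auto
  then show "a n = 0"
  proof cases
    case 1
    then show ?thesis using chain[of 1] card_reversal_classes_base by simp
  next
    case 2
    have "n \<noteq> 10 + 2 * m" for m using 2 by auto
    then show ?thesis unfolding a_def using 2 \<open>n > 0\<close> by (intro num_graphs_other) auto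
  qed
next
  have chain: "a (10 + 2 * m) = card (reversal_classes m)" for m
    unfolding a_def by (rule num_graphs_chain)
  assume "n \<in> {4, 6, 10, 14, 16, 18, 20}"
  moreover have "a 4 = 1" "a 6 = 1" unfolding a_def by (rule num_graphs_4 num_graphs_6)+
  moreover have "a 10 = 1" "a 14 = 1" "a 16 = 1" "a 18 = 1" "a 20 = 1"
    using chain[of 0] chain[of 2] chain[of 3] chain[of 4] chain[of 5] card_reversal_classes_base by simp_all
  ultimately show "a n = 1" by auto
next
  have chain: "a (10 + 2 * m) = card (reversal_classes m)" for m
    unfolding a_def by (rule num_graphs_chain)
  assume n: "even n \<and> n > 20"
  \<comment> \<open>The sum of the composition, the two caps taking 10 vertices. As n is even, n >
    20 means \<open>6 \<le> m\<close>, and n divisible by 4 means that \<open>m\<close> is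
    odd.\<close>
  define m where "m = (n - 10) div 2"
  have m: "n = 10 + 2 * m" "6 \<le> m" using n by (auto simp: m_def)
  then have "n - 4 = 10 + 2 * (m - 2)" "n - 6 = 10 + 2 * (m - 3)" by auto
  then have a: "a n = card (reversal_classes m)" "a (n - 4) = card (reversal_classes (m - 2))"
    "a (n - 6) = card (reversal_classes (m - 3))" using chain m(1) by metis+
  {
    assume "n mod 4 = 2"
    then have "even m" using m by presburger
    then show "int (a n) = int (a (n - 4)) + int (a (n - 6))"
      using card_reversal_classes_even[OF m(2)] by (simp add: a)
  next
    assume "n mod 4 = 0"
    then have "odd m" using m by presburger
    moreover have "(n - 20) div 4 = (m - 5) div 2" using m by auto
    ultimately show "int (a n) = int (a (n - 4)) + int (a (n - 6)) - int (t ((n - 20) div 4))"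
      using card_reversal_classes_odd[OF m(2)] by (simp add: a t_def)
  }
qed

end
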